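(* Let $-\infty<a<b<\infty$. Consider the equation $${}^{C}D_a^{\alpha_k}x(t)=f\bigl(t,x(t),{}^{C}D_a^{\alpha_1}x(t),{}^{C}D_a^{\alpha_2}x(t),\ldots,{}^{C}D_a^{\alpha_{k-1}}x(t)\bigr),\qquad t\in[a,b],\tag{A}$$ subject to the initial conditions $$(D^jx)(a)=x_a^{(j)},\qquad j=0,1,\ldots,\lceil\alpha_k\rceil-1,\tag{B}$$ where $\alpha_k>\alpha_{k-1}>\cdots>\alpha_1>0$ are real numbers with $\alpha_j-\alpha_{j-1}\le 1$ for all $j=2,3,\ldots,k$ and $0<\alpha_1\le 1$, and $f:[a,b]\times\mathbb{R}^k\to\mathbb{R}$ is a continuous function. Assume that $f$ satisfies a uniform Lipschitz condition, i.e. there exists a constant $L>0$ such that $$|f(t,y)-f(t,z)|\le L\|y-z\|\quad\text{for all } t\in[a,b],\ y,z\in\mathbb{R}^k.$$ Then for any initial values $x_a^{(j)}\in\mathbb{R}$, $j=0,1,\ldots,\lceil\alpha_k\rceil-1$, there exists a unique solution $x:[a,b]\to\mathbb{R}$ of the equation (A) that satisfies the initial conditions (B).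
   Context: For $\alpha>0$, $J_a^\alpha f(x):=\frac{1}{\Gamma(\alpha)}\int_a^x (x-t)^{\alpha-1}f(t)\,dt$ for $a\le x\le b$; $J_a^0$ is the identity. $D^m$ denotes the ordinary derivative of integer order $m$. For $\alpha>0$ and $m:=\lceil\alpha\rceil$ put ${}^{RL}D_a^{\alpha}f:=D^mJ_a^{m-\alpha}f$. For $\alpha>0$, $m:=\lceil\alpha\rceil$ and $f\in C^{m-1}[a,b]$, the Caputo fractional derivative of order $\alpha$ is ${}^{C}D_a^{\alpha}f:={}^{RL}D_a^{\alpha}(f-T_{m-1}[f;a])$, where $T_{m-1}[f;a](t):=\sum_{k=0}^{m-1}\frac{(D^kf)(a)}{k!}(t-a)^k$. A function $f\in C^{m-1}[a,b]$ is called continuously Caputo $\alpha$-differentiable if ${}^{C}D_a^{\alpha}f$ exists and belongs to $C[a,b]$. A solution of (A) is a function $x:[a,b]\to\mathbb{R}$ that is continuously Caputo $\alpha_k$-differentiable (in particular $x\in C^{\lceil\alpha_k\rceil-1}[a,b]$) and satisfies (A) on $[a,b]$. *)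

theory Defs
  imports "HOL-Analysis.Analysis"
begin

definition RL_integral :: "real \<Rightarrow> real \<Rightarrow> (real \<Rightarrow> real) \<Rightarrow> real \<Rightarrow> real" where
  "RL_integral a \<alpha> f x =
     (if \<alpha> = 0 then f x
      else 1 / Gamma \<alpha> * (LBINT t:{a..x}. (x - t) powr (\<alpha> - 1) * f t))"

(* Derivatives are taken within the interval, hence one-sided at its end points, and at points of
   the interval they depend only on the restriction of the function to it. *)
definition deriv_within :: "real set \<Rightarrow> nat \<Rightarrow> (real \<Rightarrow> real) \<Rightarrow> real \<Rightarrow> real" where
  "deriv_within S n f = ((\<lambda>g x. vector_derivative g (at x within S)) ^^ n) f"

definition times_differentiable_on :: "nat \<Rightarrow> (real \<Rightarrow> real) \<Rightarrow> real set \<Rightarrow> bool" where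
  "times_differentiable_on n f S \<longleftrightarrow> (\<forall>j<n. deriv_within S j f differentiable_on S)"

definition times_cont_differentiable_on :: "nat \<Rightarrow> (real \<Rightarrow> real) \<Rightarrow> real set \<Rightarrow> bool" where
  "times_cont_differentiable_on n f S \<longleftrightarrow>
     times_differentiable_on n f S \<and> continuous_on S (deriv_within S n f)"

definition taylor_poly :: "real \<Rightarrow> real \<Rightarrow> nat \<Rightarrow> (real \<Rightarrow> real) \<Rightarrow> real \<Rightarrow> real" where
  "taylor_poly a b n f t = (\<Sum>k\<le>n. deriv_within {a..b} k f a / fact k * (t - a) ^ k)"

(* As for deriv and vector_derivative, the value of a fractional derivative is only meaningful
   where the corresponding differentiability predicate holds. *)
definition RL_deriv :: "real \<Rightarrow> real \<Rightarrow> real \<Rightarrow> (real \<Rightarrow> real) \<Rightarrow> real \<Rightarrow> real" where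
  "RL_deriv a b \<alpha> f = (let m = nat \<lceil>\<alpha>\<rceil> in deriv_within {a..b} m (RL_integral a (real m - \<alpha>) f))"

definition RL_differentiable :: "real \<Rightarrow> real \<Rightarrow> real \<Rightarrow> (real \<Rightarrow> real) \<Rightarrow> bool" where
  "RL_differentiable a b \<alpha> f \<longleftrightarrow>
     (let m = nat \<lceil>\<alpha>\<rceil> in times_differentiable_on m (RL_integral a (real m - \<alpha>) f) {a..b})"

definition caputo_deriv :: "real \<Rightarrow> real \<Rightarrow> real \<Rightarrow> (real \<Rightarrow> real) \<Rightarrow> real \<Rightarrow> real" where
  "caputo_deriv a b \<alpha> f = RL_deriv a b \<alpha> (\<lambda>t. f t - taylor_poly a b (nat \<lceil>\<alpha>\<rceil> - 1) f t)"

definition caputo_differentiable :: "real \<Rightarrow> real \<Rightarrow> real \<Rightarrow> (real \<Rightarrow> real) \<Rightarrow> bool" where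
  "caputo_differentiable a b \<alpha> f \<longleftrightarrow>
     times_cont_differentiable_on (nat \<lceil>\<alpha>\<rceil> - 1) f {a..b} \<and>
     RL_differentiable a b \<alpha> (\<lambda>t. f t - taylor_poly a b (nat \<lceil>\<alpha>\<rceil> - 1) f t)"

definition cont_caputo_differentiable :: "real \<Rightarrow> real \<Rightarrow> real \<Rightarrow> (real \<Rightarrow> real) \<Rightarrow> bool" where
  "cont_caputo_differentiable a b \<alpha> f \<longleftrightarrow>
     caputo_differentiable a b \<alpha> f \<and> continuous_on {a..b} (caputo_deriv a b \<alpha> f)"

(* The vector (x(t), D^(alpha 1) x(t), ..., D^(alpha (k-1)) x(t)) as a point of Euclidean_space k,
   whose points are the sequences vanishing from index k on. *)
definition rhs_args ::
    "real \<Rightarrow> real \<Rightarrow> nat \<Rightarrow> (nat \<Rightarrow> real) \<Rightarrow> (real \<Rightarrow> real) \<Rightarrow> real \<Rightarrow> nat \<Rightarrow> real" where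
  "rhs_args a b k \<alpha> x t =
     (\<lambda>i. if i = 0 then x t else if i < k then caputo_deriv a b (\<alpha> i) x t else 0)"

(* The second conjunct says that every term of the equation is defined; the orders alpha 1, ...,
   alpha k are indexed from 1. *)
definition multi_term_solution ::
    "real \<Rightarrow> real \<Rightarrow> nat \<Rightarrow> (nat \<Rightarrow> real) \<Rightarrow> (real \<times> (nat \<Rightarrow> real) \<Rightarrow> real) \<Rightarrow> (real \<Rightarrow> real) \<Rightarrow> bool" where
  "multi_term_solution a b k \<alpha> f x \<longleftrightarrow>
     cont_caputo_differentiable a b (\<alpha> k) x \<and>
     (\<forall>j\<in>{1..<k}. caputo_differentiable a b (\<alpha> j) x) \<and>
     (\<forall>t\<in>{a..b}. caputo_deriv a b (\<alpha> k) x t = f (t, rhs_args a b k \<alpha> x t))"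

end

theory Submission imports Defs begin

text \<open>With \<open>\<gamma> = \<alpha> k\<close>, a function \<open>x\<close> is continuously Caputo \<open>\<gamma>\<close>-differentiable with derivative
  \<open>y\<close> iff it is its Taylor polynomial at \<open>a\<close> plus the fractional integral of order \<open>\<gamma>\<close> of the
  continuous function \<open>y\<close>. Its Caputo derivative of a smaller order \<open>\<alpha> i\<close> is then a fixed continuous
  function, determined by the initial values, plus the fractional integral of order \<open>\<gamma> - \<alpha> i > 0\<close>
  of \<open>y\<close>. So the initial value problem is equivalent to a fixed point equation for \<open>y\<close> whose right-hand
  side is Lipschitz in fractional integrals of positive order; it is a contraction for the supremum
  norm weighted by \<open>exp (- \<omega> * t)\<close> with \<open>\<omega>\<close> large.\<close>

section \<open>Riemann--Liouville integrals\<close>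

text \<open>The delicate half of the equivalence is the recovery of \<open>x\<close> from
  \<open>y\<close>. Writing J for the fractional integral and D for the derivative, the hypothesis
  only says that D^m J^(m - \<gamma>) can be applied to \<open>x\<close> minus its Taylor
  polynomial; that difference itself has only m - 1 derivatives. The way out is Abel's trick. With
  \<delta> = m - \<gamma> in [0,1) and u the derivative of order m - 1 of the difference, the
  hypothesis reduces to J^\<delta> u = J^1 y. Applying J^(1 - \<delta>) raises the order on u to
  exactly 1, where differentiation is legitimate. This rests on the semigroup law, whose source is
  the Beta integral. For orders below 1 the kernel is unbounded. Limits and estimates are therefore
  taken after the substitution u = x - t, which pins the singularity at 0 and separates it from the
  function. The exponential weight contracts on the whole interval at once: the integral of
  u^(\<beta> - 1) exp (- \<omega> u) over [0, b - a] tends to 0 as \<omega> grows, so no gluing of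
  solutions on short intervals occurs.\<close>

lemma integrable_powr_kernel:
  fixes \<alpha> c :: real
  assumes "\<alpha> > 0"
  shows "integrable lborel (\<lambda>u. indicator {0..c} u * u powr (\<alpha> - 1))"
proof (cases "c \<ge> 0")
  case True
  have "(\<lambda>t. t powr (\<alpha> - 1)) integrable_on {0..c}"
    by (rule integrable_on_powr_from_0) (use assms True in auto)
  hence "(\<lambda>t. t powr (\<alpha> - 1)) absolutely_integrable_on {0..c}"
    by (subst absolutely_integrable_on_iff_nonneg) auto
  then show ?thesis
    unfolding set_integrable_def by (subst (asm) integrable_completion) auto
qed simp

lemma measurable_indicator_mult:
  fixes y :: "real \<Rightarrow> real"
  assumes "continuous_on {a..b} y"
  shows "(\<lambda>t. indicator {a..b} t * y t) \<in> borel_measurable borel"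
  using borel_measurable_continuous_on_indicator[OF _ assms] by simp

lemma continuous_on_Icc_bounded:
  fixes y :: "real \<Rightarrow> real"
  assumes "continuous_on {a..b} y"
  obtains M where "M \<ge> 0" "\<And>t. t \<in> {a..b} \<Longrightarrow> \<bar>y t\<bar> \<le> M"
proof -
  have "bounded (y ` {a..b})"
    using assms by (intro compact_imp_bounded compact_continuous_image) auto
  then obtain M where M: "\<forall>t\<in>{a..b}. \<bar>y t\<bar> \<le> M"
    by (auto simp: bounded_iff)
  show ?thesis by (rule that[of "max M 0"]) (use M in \<open>auto intro: max.coboundedI1\<close>)
qed

lemma integrable_powr_kernel_mult:
  fixes Y :: "real \<Rightarrow> real"
  assumes "\<alpha> > 0" "Y \<in> borel_measurable borel" "\<And>t. \<bar>Y t\<bar> \<le> M"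
  shows "integrable lborel (\<lambda>u. indicator {0..c} u * u powr (\<alpha> - 1) * Y (x - u))"
proof (rule Bochner_Integration.integrable_bound)
  show "integrable lborel (\<lambda>u. M * (indicator {0..c} u * u powr (\<alpha> - 1)))"
    using integrable_powr_kernel[OF assms(1)] by (rule integrable_mult_right)
  show "(\<lambda>u. indicator {0..c} u * u powr (\<alpha> - 1) * Y (x - u)) \<in> borel_measurable lborel"
    using assms(2) by measurable
  have "M \<ge> 0" using assms(3)[of 0] by linarith
  then show "AE u in lborel. norm (indicator {0..c} u * u powr (\<alpha> - 1) * Y (x - u))
      \<le> norm (M * (indicator {0..c} u * u powr (\<alpha> - 1)))"
    using assms(3) by (auto simp: abs_mult indicator_def mult.commute[of M] intro!: AE_I2 mult_left_mono)
qed

lemma RL_integral_0 [simp]: "RL_integral a 0 f = f"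
  by (simp add: RL_integral_def fun_eq_iff)

lemma RL_integral_cong:
  assumes "\<And>t. t \<in> {a..x} \<Longrightarrow> f t = g t" "a \<le> x"
  shows "RL_integral a \<alpha> f x = RL_integral a \<alpha> g x"
  unfolding RL_integral_def using assms
  by (auto intro!: set_lebesgue_integral_cong)

text \<open>The domain of integration is a single point, hence null. Order 0 is excluded because
  there the integral is \<open>f\<close> itself.\<close>

lemma RL_integral_at_left_end:
  assumes "\<alpha> \<noteq> 0"
  shows "RL_integral a \<alpha> f a = 0"
proof -
  have "AE t in lborel. t \<noteq> a" by (rule AE_lborel_singleton)
  then have "AE t in lborel. indicator {a..a} t *\<^sub>R ((a - t) powr (\<alpha> - 1) * f t) = 0"
    by eventually_elim auto
  then show ?thesis
    using assms by (simp add: RL_integral_def set_lebesgue_integral_def integral_eq_zero_AE)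
qed

text \<open>The substitution u = x - t leaves \<open>x\<close> only in the factor \<open>y\<close>
  truncated to \<open>{a..b}\<close>; the kernel and its domain \<open>{0..b - a}\<close> are the
  same for all \<open>x\<close>. One integrable majorant then serves every \<open>x\<close>.\<close>

lemma RL_integral_eq_convolution:
  assumes "\<alpha> > 0" "x \<in> {a..b}"
  shows "RL_integral a \<alpha> y x = 1 / Gamma \<alpha> *
    (\<integral>u. indicator {0..b - a} u * u powr (\<alpha> - 1) * (indicator {a..b} (x - u) * y (x - u)) \<partial>lborel)"
proof -
  have "(LBINT t:{a..x}. (x - t) powr (\<alpha> - 1) * y t) =
    \<bar>-1\<bar> *\<^sub>R (\<integral>u. indicator {a..x} (x + (-1) * u) *\<^sub>R
       ((x - (x + (-1) * u)) powr (\<alpha> - 1) * y (x + (-1) * u)) \<partial>lborel)"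
    unfolding set_lebesgue_integral_def by (rule lborel_integral_real_affine) simp
  also have "\<dots> = (\<integral>u. indicator {0..b - a} u * u powr (\<alpha> - 1) * (indicator {a..b} (x - u) * y (x - u)) \<partial>lborel)"
    unfolding abs_minus abs_one scaleR_one
    by (rule Bochner_Integration.integral_cong) (use assms in \<open>auto simp: indicator_def\<close>)
  finally show ?thesis using assms by (simp add: RL_integral_def)
qed

lemma RL_integrable:
  fixes y :: "real \<Rightarrow> real"
  assumes "\<alpha> > 0" "continuous_on {a..b} y" "x \<in> {a..b}"
  shows "set_integrable lborel {a..x} (\<lambda>t. (x - t) powr (\<alpha> - 1) * y t)"
proof -
  obtain M where M: "M \<ge> 0" "\<And>t. t \<in> {a..b} \<Longrightarrow> \<bar>y t\<bar> \<le> M"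
    using continuous_on_Icc_bounded[OF assms(2)] by blast
  have "integrable lborel (\<lambda>u. indicator {0..b - a} u * u powr (\<alpha> - 1) * (indicator {a..b} (x - u) * y (x - u)))"
    using M
    by (intro integrable_powr_kernel_mult[where M = M and Y = "\<lambda>t. indicator {a..b} t * y t"]
          assms measurable_indicator_mult) (auto simp: indicator_def)
  then have "integrable lborel (\<lambda>t. indicator {0..b - a} (x + (-1) * t) * (x + (-1) * t) powr (\<alpha> - 1)
      * (indicator {a..b} (x - (x + (-1) * t)) * y (x - (x + (-1) * t))))"
    by (rule lborel_integrable_real_affine) simp
  then show ?thesis
    unfolding set_integrable_def
    by (rule Bochner_Integration.integrable_cong[THEN iffD1, rotated 2])
       (use assms in \<open>auto simp: indicator_def\<close>)
qed

text \<open>Dominated convergence in the convolution form, with M times the kernel as majorant,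
  where M bounds \<open>y\<close>.\<close>

lemma continuous_on_RL_integral [continuous_intros]:
  assumes "\<alpha> \<ge> 0" "continuous_on {a..b} y"
  shows "continuous_on {a..b} (RL_integral a \<alpha> y)"
proof (cases "\<alpha> = 0")
  case False
  with assms have \<alpha>: "\<alpha> > 0" by simp
  obtain M where M: "M \<ge> 0" "\<And>t. t \<in> {a..b} \<Longrightarrow> \<bar>y t\<bar> \<le> M"
    using continuous_on_Icc_bounded[OF assms(2)] by blast
  define Y where "Y = (\<lambda>t. indicator {a..b} t * y t)"
  have Y [measurable]: "Y \<in> borel_measurable borel"
    unfolding Y_def by (rule measurable_indicator_mult[OF assms(2)])
  have YM: "\<bar>Y t\<bar> \<le> M" for t using M by (auto simp: Y_def indicator_def)
  define I where "I x = (\<integral>u. indicator {0..b - a} u * u powr (\<alpha> - 1) * Y (x - u) \<partial>lborel)" for x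
  have "continuous_on {a..b} I"
  proof (rule continuous_on_sequentiallyI)
    fix v x assume v: "\<forall>n. v n \<in> {a..b}" "x \<in> {a..b}" "v \<longlonglongrightarrow> x"
    show "(\<lambda>n. I (v n)) \<longlonglongrightarrow> I x"
      unfolding I_def
    proof (rule integral_dominated_convergence)
      show "integrable lborel (\<lambda>u. M * (indicator {0..b - a} u * u powr (\<alpha> - 1)))"
        using integrable_powr_kernel[OF \<alpha>] by (rule integrable_mult_right)
      show "AE u in lborel. norm (indicator {0..b - a} u * u powr (\<alpha> - 1) * Y (v n - u))
          \<le> M * (indicator {0..b - a} u * u powr (\<alpha> - 1))" for n
        using YM by (auto simp: abs_mult indicator_def mult.commute[of M] intro!: AE_I2 mult_left_mono)
      show "AE u in lborel. (\<lambda>n. indicator {0..b - a} u * u powr (\<alpha> - 1) * Y (v n - u))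
          \<longlonglongrightarrow> indicator {0..b - a} u * u powr (\<alpha> - 1) * Y (x - u)"
        \<comment> \<open>The extension of \<open>y\<close> by zero may jump at \<open>a\<close>, so
          pointwise convergence can fail at u = x - a; this one point is discarded.\<close>
        using AE_lborel_singleton[of "x - a"]
      proof eventually_elim
        case (elim u)
        have "(\<lambda>n. Y (v n - u)) \<longlonglongrightarrow> Y (x - u)" if u: "u \<in> {0..b - a}"
        proof (cases "x - u > a")
          case True
          have lim: "(\<lambda>n. v n - u) \<longlonglongrightarrow> x - u" by (intro tendsto_intros v)
          have ev: "\<forall>\<^sub>F n in sequentially. v n - u \<in> {a..b}"
            using order_tendstoD(1)[OF lim True]
          proof eventually_elim
            case (elim n)
            then show ?case using v(1)[rule_format, of n] u by auto
          qed
          have "(\<lambda>n. y (v n - u)) \<longlonglongrightarrow> y (x - u)"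
            by (rule continuous_on_tendsto_compose[OF assms(2) lim _ ev]) (use True u v in auto)
          moreover have "y (x - u) = Y (x - u)" using True u v by (auto simp: Y_def)
          ultimately have lim_y: "(\<lambda>n. y (v n - u)) \<longlonglongrightarrow> Y (x - u)" by simp
          have "\<forall>\<^sub>F n in sequentially. y (v n - u) = Y (v n - u)"
            using ev by eventually_elim (auto simp: Y_def)
          with lim_y show ?thesis by (rule Lim_transform_eventually)
        next
          case False
          with elim have "x - u < a" by auto
          have lim: "(\<lambda>n. v n - u) \<longlonglongrightarrow> x - u" by (intro tendsto_intros v)
          have "\<forall>\<^sub>F n in sequentially. v n - u < a"
            using order_tendstoD(2)[OF lim \<open>x - u < a\<close>] .
          then have "\<forall>\<^sub>F n in sequentially. Y (v n - u) = Y (x - u)"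
            by eventually_elim (use \<open>x - u < a\<close> in \<open>auto simp: Y_def\<close>)
          then show ?thesis by (rule tendsto_eventually)
        qed
        then show ?case by (cases "u \<in> {0..b - a}") (auto intro!: tendsto_intros)
      qed
    qed measurable
  qed
  then have "continuous_on {a..b} (\<lambda>x. 1 / Gamma \<alpha> * I x)" by (intro continuous_intros)
  then show ?thesis
    by (rule continuous_on_cong[THEN iffD1, rotated 2])
       (use RL_integral_eq_convolution[OF \<alpha>] in \<open>auto simp: I_def Y_def\<close>)
qed (use assms in simp)

lemma RL_integral_add:
  assumes "\<alpha> \<ge> 0" "continuous_on {a..b} y" "continuous_on {a..b} z" "x \<in> {a..b}"
  shows "RL_integral a \<alpha> (\<lambda>t. y t + z t) x = RL_integral a \<alpha> y x + RL_integral a \<alpha> z x"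
  using assms RL_integrable[of \<alpha> a b y x] RL_integrable[of \<alpha> a b z x]
  by (cases "\<alpha> = 0") (auto simp: RL_integral_def distrib_left add_divide_distrib)

lemma RL_integral_diff:
  assumes "\<alpha> \<ge> 0" "continuous_on {a..b} y" "continuous_on {a..b} z" "x \<in> {a..b}"
  shows "RL_integral a \<alpha> (\<lambda>t. y t - z t) x = RL_integral a \<alpha> y x - RL_integral a \<alpha> z x"
  using assms RL_integrable[of \<alpha> a b y x] RL_integrable[of \<alpha> a b z x]
  by (cases "\<alpha> = 0") (auto simp: RL_integral_def right_diff_distrib diff_divide_distrib)

lemma RL_integral_mult:
  "RL_integral a \<alpha> (\<lambda>t. c * y t) x = c * RL_integral a \<alpha> y x"
  by (auto simp: RL_integral_def mult.left_commute[of _ c])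

lemma RL_integral_sum:
  assumes "\<alpha> \<ge> 0" "\<And>i. i \<in> I \<Longrightarrow> continuous_on {a..b} (y i)" "x \<in> {a..b}" "finite I"
  shows "RL_integral a \<alpha> (\<lambda>t. \<Sum>i\<in>I. y i t) x = (\<Sum>i\<in>I. RL_integral a \<alpha> (y i) x)"
  using assms(4,2)
proof (induction I)
  case empty
  then show ?case using RL_integral_mult[of a \<alpha> 0] by simp
next
  case (insert i I)
  then show ?case
    using RL_integral_add[OF assms(1) _ _ assms(3), of "y i" "\<lambda>t. \<Sum>i\<in>I. y i t"]
    by (auto intro!: continuous_intros)
qed

section \<open>The semigroup law of fractional integrals\<close>

text \<open>The affine substitution t = s + (x - s) v reduces to the Beta integral on
  \<open>{0..1}\<close>. Integrability is part of the claim because Fubini's theorem needs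
  it.\<close>

lemma has_bochner_integral_Beta_kernel:
  fixes \<alpha> \<beta> s x :: real
  assumes "\<alpha> > 0" "\<beta> > 0" "s < x"
  shows "has_bochner_integral lborel
    (\<lambda>t. indicator {s..x} t * ((x - t) powr (\<alpha> - 1) * (t - s) powr (\<beta> - 1)))
    (Beta \<beta> \<alpha> * (x - s) powr (\<alpha> + \<beta> - 1))"
proof -
  let ?B = "\<lambda>v. indicator {0..1} v * (v powr (\<beta> - 1) * (1 - v) powr (\<alpha> - 1)) :: real"
  have int: "integrable lborel ?B"
    using integrable_Beta[OF assms(2,1)] by (simp add: set_integrable_def)
  have "(\<integral>v. ?B v \<partial>lborel) = integral {0..1} (\<lambda>v. v powr (\<beta> - 1) * (1 - v) powr (\<alpha> - 1))"
    using set_borel_integral_eq_integral(2)[OF integrable_Beta[OF assms(2,1)]]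
    by (simp add: set_lebesgue_integral_def)
  also have "\<dots> = Beta \<beta> \<alpha>"
    using has_integral_Beta_real[OF assms(2,1)] by (rule integral_unique)
  finally have "has_bochner_integral lborel ?B (Beta \<beta> \<alpha>)"
    using int by (simp add: has_bochner_integral_iff)
  \<comment> \<open>The two kernels contribute the exponents \<alpha> - 1 and \<beta> - 1, in total
    \<alpha> + \<beta> - 2; the Jacobian x - s supplies the missing 1.\<close>
  then have "has_bochner_integral lborel (\<lambda>v. (x - s) powr (\<alpha> + \<beta> - 2) * ?B v)
      ((x - s) powr (\<alpha> + \<beta> - 2) * Beta \<beta> \<alpha>)"
    by (rule has_bochner_integral_mult_right)
  moreover have "(x - s) powr (\<alpha> + \<beta> - 2) * ?B v = indicator {s..x} (s + (x - s) * v) *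
      ((x - (s + (x - s) * v)) powr (\<alpha> - 1) * (s + (x - s) * v - s) powr (\<beta> - 1))" for v
  proof (cases "v \<in> {0..1}")
    case True
    have "x - (s + (x - s) * v) = (x - s) * (1 - v)" by (simp add: algebra_simps)
    moreover have "s + (x - s) * v \<in> {s..x}"
    proof -
      have "(x - s) * v \<le> x - s" using True assms by (intro mult_left_le) auto
      moreover have "0 \<le> (x - s) * v" using True assms by simp
      ultimately show ?thesis by simp
    qed
    moreover have "(x - s) powr (\<alpha> + \<beta> - 2) = (x - s) powr (\<alpha> - 1) * (x - s) powr (\<beta> - 1)"
      by (simp add: powr_add [symmetric] algebra_simps)
    ultimately show ?thesis using True assms by (simp add: powr_mult mult_ac)
  next
    case False
    have "s + (x - s) * v \<notin> {s..x}"
    proof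
      assume "s + (x - s) * v \<in> {s..x}"
      then have "0 \<le> (x - s) * v" "(x - s) * v \<le> (x - s) * 1" by auto
      then show False using False assms by (simp only: zero_le_mult_iff mult_le_cancel_left) auto
    qed
    then show ?thesis using False by simp
  qed
  moreover have "(x - s) powr (\<alpha> + \<beta> - 2) * Beta \<beta> \<alpha> =
      (Beta \<beta> \<alpha> * (x - s) powr (\<alpha> + \<beta> - 1)) /\<^sub>R \<bar>x - s\<bar>"
  proof -
    have "(x - s) powr (\<alpha> + \<beta> - 2) = (x - s) powr ((\<alpha> + \<beta> - 1) - 1)" by simp
    also have "\<dots> = (x - s) powr (\<alpha> + \<beta> - 1) / (x - s)"
      using assms by (subst powr_diff) simp
    finally show ?thesis
      using assms by (simp only: abs_of_pos diff_gt_0_iff_gt real_scaleR_def) (simp add: divide_inverse mult_ac)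
  qed
  ultimately show ?thesis
    using assms by (subst lborel_has_bochner_integral_real_affine_iff[of "x - s" _ _ s]) simp_all
qed

text \<open>Fubini on the triangle a \<le> s \<le> t \<le> x: the product of both kernels integrated
  over t is a Beta integral, and
  \<open>Beta \<beta> \<alpha> / (Gamma \<alpha> * Gamma \<beta>)\<close> is
  \<open>1 / Gamma (\<alpha> + \<beta>)\<close>. If one order is 0, that integral is the
  identity.\<close>

lemma RL_integral_RL_integral:
  assumes "\<alpha> \<ge> 0" "\<beta> \<ge> 0" "continuous_on {a..b} y" "x \<in> {a..b}"
  shows "RL_integral a \<alpha> (RL_integral a \<beta> y) x = RL_integral a (\<alpha> + \<beta>) y x"
proof (cases "\<alpha> = 0 \<or> \<beta> = 0")
  case False
  with assms have \<alpha>: "\<alpha> > 0" and \<beta>: "\<beta> > 0" by auto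
  define Y where "Y = (\<lambda>t. indicator {a..b} t * y t)"
  have Y [measurable]: "Y \<in> borel_measurable borel"
    unfolding Y_def by (rule measurable_indicator_mult[OF assms(3)])
  \<comment> \<open>The triangle is encoded by \<open>if\<close>, which makes joint measurability in
    s and t automatic; \<open>g_eq\<close> restores the interval form that the Beta integral
    expects.\<close>
  define g where "g s t = indicator {a..x} s * (if s \<le> t \<and> t \<le> x then 1 else 0) *
      ((x - t) powr (\<alpha> - 1) * (t - s) powr (\<beta> - 1)) * Y s" for s t
  have g_eq: "g s t = (indicator {a..x} s * Y s) *
      (indicator {s..x} t * ((x - t) powr (\<alpha> - 1) * (t - s) powr (\<beta> - 1)))" for s t
    by (auto simp: g_def indicator_def)
  have g_abs: "\<bar>g s t\<bar> = \<bar>indicator {a..x} s * Y s\<bar> *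
      (indicator {s..x} t * ((x - t) powr (\<alpha> - 1) * (t - s) powr (\<beta> - 1)))" for s t
    by (auto simp: g_eq abs_mult indicator_def)
  have g_meas: "case_prod g \<in> borel_measurable (lborel \<Otimes>\<^sub>M lborel)"
    unfolding g_def by measurable
  have g_abs_meas: "(\<lambda>(s, t). \<bar>g s t\<bar>) \<in> borel_measurable (lborel \<Otimes>\<^sub>M lborel)"
    using borel_measurable_abs[OF g_meas] by (simp add: case_prod_unfold)
  have inner: "has_bochner_integral lborel (g s)
      ((indicator {a..x} s * Y s) * (Beta \<beta> \<alpha> * (x - s) powr (\<alpha> + \<beta> - 1)))"
    and inner_abs: "has_bochner_integral lborel (\<lambda>t. \<bar>g s t\<bar>)
      (\<bar>indicator {a..x} s * Y s\<bar> * (Beta \<beta> \<alpha> * (x - s) powr (\<alpha> + \<beta> - 1)))"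
    if "s \<noteq> x" for s
  proof (atomize (full), cases "s < x")
    case True
    note * = has_bochner_integral_mult_right[OF has_bochner_integral_Beta_kernel[OF \<alpha> \<beta> True]]
    show "has_bochner_integral lborel (g s)
      ((indicator {a..x} s * Y s) * (Beta \<beta> \<alpha> * (x - s) powr (\<alpha> + \<beta> - 1))) \<and>
      has_bochner_integral lborel (\<lambda>t. \<bar>g s t\<bar>)
      (\<bar>indicator {a..x} s * Y s\<bar> * (Beta \<beta> \<alpha> * (x - s) powr (\<alpha> + \<beta> - 1)))"
      unfolding g_abs unfolding g_eq[abs_def] by (intro conjI *)
  next
    case False
    with that have "g s = (\<lambda>t. 0)" by (auto simp: g_def)
    then show "has_bochner_integral lborel (g s)
      ((indicator {a..x} s * Y s) * (Beta \<beta> \<alpha> * (x - s) powr (\<alpha> + \<beta> - 1))) \<and>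
      has_bochner_integral lborel (\<lambda>t. \<bar>g s t\<bar>)
      (\<bar>indicator {a..x} s * Y s\<bar> * (Beta \<beta> \<alpha> * (x - s) powr (\<alpha> + \<beta> - 1)))"
      using False that by (simp add: has_bochner_integral_zero)
  qed
  have kernel: "set_integrable lborel {a..x} (\<lambda>s. (x - s) powr (\<alpha> + \<beta> - 1) * y s)"
    using \<alpha> \<beta> assms by (intro RL_integrable) auto
  have outer: "indicator {a..x} s * Y s * (Beta \<beta> \<alpha> * (x - s) powr (\<alpha> + \<beta> - 1)) =
      Beta \<beta> \<alpha> * (indicator {a..x} s *\<^sub>R ((x - s) powr (\<alpha> + \<beta> - 1) * y s))" for s
    using assms(4) by (auto simp: Y_def indicator_def)
  have Beta_pos: "Beta \<beta> \<alpha> > 0"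
    using \<alpha> \<beta> by (simp add: Beta_def Gamma_real_pos)
  have AE_x: "AE s in lborel. s \<noteq> x" by (rule AE_lborel_singleton)
  have g_int: "integrable (lborel \<Otimes>\<^sub>M lborel) (case_prod g)"
  proof (rule lborel_pair.Fubini_integrable[OF g_meas])
    show "AE s in lborel. integrable lborel (\<lambda>t. case (s, t) of (s, t) \<Rightarrow> g s t)"
      using AE_x by eventually_elim (use inner in \<open>auto simp: has_bochner_integral_iff\<close>)
    \<comment> \<open>For almost every s, integrating |g s t| over t gives the absolute value of the
      integrand of order \<alpha> + \<beta> times the Beta constant, so Fubini's condition follows
      from integrability at that order.\<close>
    have "integrable lborel (\<lambda>s. \<bar>Beta \<beta> \<alpha> * (indicator {a..x} s *\<^sub>R ((x - s) powr (\<alpha> + \<beta> - 1) * y s))\<bar>)"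
      using kernel unfolding set_integrable_def by (intro integrable_abs integrable_mult_right)
    then show "integrable lborel (\<lambda>s. \<integral>t. norm (case (s, t) of (s, t) \<Rightarrow> g s t) \<partial>lborel)"
    proof (rule integrable_cong_AE_imp)
      show "(\<lambda>s. \<integral>t. norm (case (s, t) of (s, t) \<Rightarrow> g s t) \<partial>lborel) \<in> borel_measurable lborel"
        using lborel.borel_measurable_lebesgue_integral[OF g_abs_meas] by simp
      show "AE s in lborel. \<bar>Beta \<beta> \<alpha> * (indicator {a..x} s *\<^sub>R ((x - s) powr (\<alpha> + \<beta> - 1) * y s))\<bar> =
          (\<integral>t. norm (case (s, t) of (s, t) \<Rightarrow> g s t) \<partial>lborel)"
        using AE_x
      proof eventually_elim
        case (elim s)
        from inner_abs[OF this] show ?case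
          unfolding outer[symmetric] using Beta_pos
          by (simp add: has_bochner_integral_iff abs_mult)
      qed
    qed
  qed
  have "(\<integral>t. (\<integral>s. g s t \<partial>lborel) \<partial>lborel) = (\<integral>s. (\<integral>t. g s t \<partial>lborel) \<partial>lborel)"
    by (rule lborel_pair.Fubini_integral[OF g_int])
  also have "\<dots> = (\<integral>s. Beta \<beta> \<alpha> * (indicator {a..x} s *\<^sub>R ((x - s) powr (\<alpha> + \<beta> - 1) * y s)) \<partial>lborel)"
  proof (rule integral_cong_AE)
    show "(\<lambda>s. \<integral>t. g s t \<partial>lborel) \<in> borel_measurable lborel"
      by (rule lborel.borel_measurable_lebesgue_integral[OF g_meas])
    show "AE s in lborel. (\<integral>t. g s t \<partial>lborel) =
        Beta \<beta> \<alpha> * (indicator {a..x} s *\<^sub>R ((x - s) powr (\<alpha> + \<beta> - 1) * y s))"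
      using AE_x
    proof eventually_elim
      case (elim s)
      from inner[OF this] show ?case
        unfolding outer[symmetric] by (simp add: has_bochner_integral_iff)
    qed
    show "(\<lambda>s. Beta \<beta> \<alpha> * (indicator {a..x} s *\<^sub>R ((x - s) powr (\<alpha> + \<beta> - 1) * y s))) \<in> borel_measurable lborel"
      unfolding outer[symmetric] by measurable
  qed
  also have "\<dots> = Beta \<beta> \<alpha> * (LBINT s:{a..x}. (x - s) powr (\<alpha> + \<beta> - 1) * y s)"
    by (simp add: set_lebesgue_integral_def)
  also have "(\<lambda>t. \<integral>s. g s t \<partial>lborel) = (\<lambda>t. indicator {a..x} t *\<^sub>R ((x - t) powr (\<alpha> - 1) *
      (LBINT s:{a..t}. (t - s) powr (\<beta> - 1) * y s)))"
  proof
    fix t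
    have "(\<integral>s. g s t \<partial>lborel) = (\<integral>s. (indicator {a..x} t * (x - t) powr (\<alpha> - 1)) *
        (indicator {a..t} s *\<^sub>R ((t - s) powr (\<beta> - 1) * y s)) \<partial>lborel)"
      by (rule Bochner_Integration.integral_cong)
         (use assms(4) in \<open>auto simp: g_def Y_def indicator_def\<close>)
    then show "(\<integral>s. g s t \<partial>lborel) = indicator {a..x} t *\<^sub>R ((x - t) powr (\<alpha> - 1) *
      (LBINT s:{a..t}. (t - s) powr (\<beta> - 1) * y s))"
      by (simp add: set_lebesgue_integral_def)
  qed
  finally have "(LBINT t:{a..x}. (x - t) powr (\<alpha> - 1) * (LBINT s:{a..t}. (t - s) powr (\<beta> - 1) * y s)) =
      Beta \<beta> \<alpha> * (LBINT s:{a..x}. (x - s) powr (\<alpha> + \<beta> - 1) * y s)"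
    by (simp add: set_lebesgue_integral_def)
  then have eq: "(LBINT t:{a..x}. (x - t) powr (\<alpha> - 1) * (1 / Gamma \<beta> * (LBINT s:{a..t}. (t - s) powr (\<beta> - 1) * y s))) =
      1 / Gamma \<beta> * (Beta \<beta> \<alpha> * (LBINT s:{a..x}. (x - s) powr (\<alpha> + \<beta> - 1) * y s))"
    by (simp add: mult.left_commute[of _ "1 / Gamma \<beta>"] del: times_divide_eq_left times_divide_eq_right)
  have nz: "Gamma \<alpha> \<noteq> 0" "Gamma \<beta> \<noteq> 0" "Gamma (\<alpha> + \<beta>) \<noteq> 0" "\<alpha> + \<beta> \<noteq> 0"
    using \<alpha> \<beta> Gamma_real_pos[of \<alpha>] Gamma_real_pos[of \<beta>] Gamma_real_pos[of "\<alpha> + \<beta>"] by (auto simp del: Gamma_real_pos)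
  have "RL_integral a \<alpha> (RL_integral a \<beta> y) x = 1 / Gamma \<alpha> * (LBINT t:{a..x}. (x - t) powr (\<alpha> - 1) *
      (1 / Gamma \<beta> * (LBINT s:{a..t}. (t - s) powr (\<beta> - 1) * y s)))"
    using \<alpha> \<beta> by (simp add: RL_integral_def)
  also have "\<dots> = RL_integral a (\<alpha> + \<beta>) y x"
    unfolding eq using nz by (simp add: RL_integral_def Beta_def divide_simps add.commute)
  finally show ?thesis .
qed auto

section \<open>Order one and differentiation\<close>

lemma RL_integral_1_eq_integral:
  assumes "continuous_on {a..b} y" "x \<in> {a..b}"
  shows "RL_integral a 1 y x = integral {a..x} y"
proof -
  \<comment> \<open>Since \<open>0 powr 0 = 0\<close>, the kernel of order 1 is 1 only away from t =
    x, and the integrands agree merely almost everywhere.\<close>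
  have "(LBINT t:{a..x}. (x - t) powr 0 * y t) = (LBINT t:{a..x}. y t)"
  proof -
    have "AE t in lborel. t \<noteq> x" by (rule AE_lborel_singleton)
    moreover have "(\<lambda>t. indicator {a..x} t * y t) \<in> borel_measurable borel"
      using assms by (intro measurable_indicator_mult continuous_on_subset[OF assms(1)]) auto
    moreover have "(\<lambda>t. indicator {a..x} t * ((x - t) powr 0 * y t)) =
        (\<lambda>t. (x - t) powr 0 * (indicator {a..x} t * y t))" by auto
    ultimately show ?thesis
      unfolding set_lebesgue_integral_def by (intro integral_cong_AE) (auto elim!: eventually_mono)
  qed
  also have "\<dots> = integral {a..x} y"
    by (rule set_borel_integral_eq_integral(2), rule borel_integrable_atLeastAtMost')
       (use assms in \<open>auto intro: continuous_on_subset\<close>)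
  finally show ?thesis by (simp add: RL_integral_def)
qed

text \<open>By the semigroup law the function is an ordinary integral of the continuous fractional
  integral of order p - 1 \<ge> 0, so the fundamental theorem applies. At p = 1 the convention for
  order 0 gives \<open>y\<close>.\<close>

lemma RL_integral_has_derivative:
  assumes "p \<ge> 1" "continuous_on {a..b} y" "x \<in> {a..b}"
  shows "(RL_integral a p y has_vector_derivative RL_integral a (p - 1) y x) (at x within {a..b})"
proof -
  have cont: "continuous_on {a..b} (RL_integral a (p - 1) y)"
    using assms by (intro continuous_on_RL_integral) auto
  have "((\<lambda>u. integral {a..u} (RL_integral a (p - 1) y)) has_vector_derivative RL_integral a (p - 1) y x)
      (at x within {a..b})"
    by (rule integral_has_vector_derivative[OF cont assms(3)])
  then show ?thesis
    by (rule has_vector_derivative_transform[rotated 2])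
       (use assms in \<open>auto simp: RL_integral_RL_integral RL_integral_1_eq_integral[OF cont, symmetric]\<close>)
qed

lemma RL_integral_1_derivative:
  assumes "continuous_on {a..b} g'"
    and "\<And>x. x \<in> {a..b} \<Longrightarrow> (g has_vector_derivative g' x) (at x within {a..b})" "x \<in> {a..b}"
  shows "RL_integral a 1 g' x = g x - g a"
proof -
  have "(g' has_integral g x - g a) {a..x}"
    by (rule fundamental_theorem_of_calculus)
       (use assms in \<open>auto intro!: has_vector_derivative_within_subset[OF assms(2)]\<close>)
  then show ?thesis
    using RL_integral_1_eq_integral[OF assms(1,3)] by (simp add: integral_unique)
qed

text \<open>Links iterated integrals of 1 to the monomials of the Taylor polynomial. Order 0
  correctly yields the constant 1 even at x = a.\<close>

lemma RL_integral_of_nat_1: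
  assumes "x \<ge> a"
  shows "RL_integral a (real n) (\<lambda>_. 1) x = (x - a) ^ n / fact n"
  using assms
proof (induction n arbitrary: x)
  case (Suc n)
  have der: "((\<lambda>t. (t - a) ^ Suc n / fact (Suc n)) has_vector_derivative (t - a) ^ n / fact n) (at t within S)" for t S
  proof -
    have "((\<lambda>t. (t - a) ^ Suc n / fact (Suc n)) has_real_derivative
        (1 + real n) * (1 * (t - a) ^ n) / fact (Suc n)) (at t within S)"
      by (intro DERIV_cdivide DERIV_power_Suc) (auto intro!: derivative_eq_intros)
    also have "(1 + real n) * (1 * (t - a) ^ n) / fact (Suc n) = (t - a) ^ n / fact n"
      by (simp add: divide_simps)
    finally show ?thesis
      by (simp add: has_real_derivative_iff_has_vector_derivative)
  qed
  have "RL_integral a (real (Suc n)) (\<lambda>_. 1) x = RL_integral a 1 (RL_integral a (real n) (\<lambda>_. 1)) x"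
    using Suc.prems by (subst RL_integral_RL_integral[where b = x]) (auto simp: add.commute)
  also have "\<dots> = RL_integral a 1 (\<lambda>t. (t - a) ^ n / fact n) x"
    using Suc by (intro RL_integral_cong) auto
  also have "\<dots> = (x - a) ^ Suc n / fact (Suc n)"
    using RL_integral_1_derivative[OF _ der, of a x x] Suc.prems
    by (simp add: continuous_intros)
  finally show ?case .
qed simp

section \<open>Caputo derivatives of fractional integrals\<close>

lemma deriv_within_0 [simp]: "deriv_within S 0 f = f"
  by (simp add: deriv_within_def)

lemma deriv_within_Suc:
  "deriv_within S (Suc n) f x = vector_derivative (deriv_within S n f) (at x within S)"
  by (simp add: deriv_within_def)

lemma has_vector_derivative_cong_on:
  fixes f g :: "real \<Rightarrow> real"
  assumes "\<And>t. t \<in> S \<Longrightarrow> f t = g t" "x \<in> S"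
  shows "(f has_vector_derivative d) (at x within S) \<longleftrightarrow> (g has_vector_derivative d) (at x within S)"
  using has_vector_derivative_transform[OF assms(2), of f g d]
    has_vector_derivative_transform[OF assms(2), of g f d] assms(1) by auto

lemma times_differentiable_on_deriv:
  assumes "times_differentiable_on n f S" "j < n" "x \<in> S"
  shows "(deriv_within S j f has_vector_derivative deriv_within S (Suc j) f x) (at x within S)"
  using assms unfolding times_differentiable_on_def differentiable_on_def deriv_within_Suc
  by (auto simp: vector_derivative_works[symmetric])

text \<open>An explicit chain of candidates in which each is the derivative of its predecessor
  identifies all iterated derivatives at once. Derivatives within \<open>{a..b}\<close> are unique
  at the end points too because a < b, and they see only values on the interval, so agreement of
  \<open>f\<close> with \<open>g 0\<close> there is enough.\<close>

lemma
  fixes a b :: real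
  assumes "a < b" and 0: "\<And>t. t \<in> {a..b} \<Longrightarrow> f t = g 0 t"
    and der: "\<And>j t. j < n \<Longrightarrow> t \<in> {a..b} \<Longrightarrow>
      (g j has_vector_derivative g (Suc j) t) (at t within {a..b})"
  shows deriv_within_chain: "j \<le> n \<Longrightarrow> t \<in> {a..b} \<Longrightarrow> deriv_within {a..b} j f t = g j t"
    and times_differentiable_on_chain: "times_differentiable_on n f {a..b}"
proof -
  have *: "\<forall>t\<in>{a..b}. deriv_within {a..b} j f t = g j t" if "j \<le> n" for j
    using that
  proof (induction j)
    case (Suc j)
    show ?case
    proof
      fix t assume t: "t \<in> {a..b}"
      have "(g j has_vector_derivative g (Suc j) t) (at t within {a..b})"
        using der Suc.prems t by simp
      then have "(deriv_within {a..b} j f has_vector_derivative g (Suc j) t) (at t within {a..b})"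
        using Suc t by (subst has_vector_derivative_cong_on[of _ _ "g j"]) auto
      then show "deriv_within {a..b} (Suc j) f t = g (Suc j) t"
        unfolding deriv_within_Suc using assms(1) t
        by (intro vector_derivative_within_closed_interval)
    qed
  qed (use 0 in simp)
  then show "j \<le> n \<Longrightarrow> t \<in> {a..b} \<Longrightarrow> deriv_within {a..b} j f t = g j t" by blast
  show "times_differentiable_on n f {a..b}"
    unfolding times_differentiable_on_def differentiable_on_def
  proof (intro allI impI ballI)
    fix j t assume jt: "j < n" "t \<in> {a..b}"
    then have "(deriv_within {a..b} j f has_vector_derivative g (Suc j) t) (at t within {a..b})"
      using der * by (subst has_vector_derivative_cong_on[of _ _ "g j"]) auto
    then show "deriv_within {a..b} j f differentiable at t within {a..b}"
      by (rule differentiableI_vector)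
  qed
qed

text \<open>Monomials \<open>(t - a) ^ i / i!\<close> are written as iterated integrals of the constant 1, so that
  polynomials and fractional integrals are handled by the same two rules: the semigroup law and
  \<open>RL_integral_has_derivative\<close>.\<close>

lemma RL_combination_has_derivative:
  assumes "finite I" "\<And>i. i \<in> I \<Longrightarrow> p i \<ge> 1 \<or> p i = 0" "q \<ge> 1"
    "continuous_on {a..b} y" "t \<in> {a..b}"
  shows "((\<lambda>t. (\<Sum>i\<in>I. c i * RL_integral a (p i) (\<lambda>_. 1) t) + RL_integral a q y t) has_vector_derivative
     (\<Sum>i\<in>{i\<in>I. p i \<noteq> 0}. c i * RL_integral a (p i - 1) (\<lambda>_. 1) t) + RL_integral a (q - 1) y t)
     (at t within {a..b})"
proof -
  have "(\<Sum>i\<in>{i\<in>I. p i \<noteq> 0}. c i * RL_integral a (p i - 1) (\<lambda>_. 1) t) =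
      (\<Sum>i\<in>I. c i * (if p i = 0 then 0 else RL_integral a (p i - 1) (\<lambda>_. 1) t))"
    using assms(1) by (intro sum.mono_neutral_cong_left) auto
  moreover have "((\<lambda>t. (\<Sum>i\<in>I. c i * RL_integral a (p i) (\<lambda>_. 1) t) + RL_integral a q y t) has_vector_derivative
     (\<Sum>i\<in>I. c i * (if p i = 0 then 0 else RL_integral a (p i - 1) (\<lambda>_. 1) t)) + RL_integral a (q - 1) y t)
     (at t within {a..b})"
  proof (intro has_vector_derivative_add has_vector_derivative_sum has_vector_derivative_mult_right)
    show "(RL_integral a q y has_vector_derivative RL_integral a (q - 1) y t) (at t within {a..b})"
      using assms by (intro RL_integral_has_derivative)
    fix i assume i: "i \<in> I"
    show "(RL_integral a (p i) (\<lambda>_. 1) has_vector_derivative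
        (if p i = 0 then 0 else RL_integral a (p i - 1) (\<lambda>_. 1) t)) (at t within {a..b})"
    proof (cases "p i = 0")
      case False
      with assms(2)[OF i] assms(5) show ?thesis
        by (auto intro!: RL_integral_has_derivative)
    qed simp
  qed
  ultimately show ?thesis by simp
qed

section \<open>Functions given as a polynomial plus a fractional integral\<close>

text \<open>Both halves of the theorem pass through this form: for existence \<open>x\<close> is
  built in it, for uniqueness a given solution is brought into it. The coefficients
  \<open>c i\<close> turn out to be the derivatives of \<open>x\<close> at \<open>a\<close>.\<close>

locale caputo_representation =
  fixes a b \<gamma> :: real and c :: "nat \<Rightarrow> real" and y x :: "real \<Rightarrow> real" and m :: nat
  assumes ab: "a < b" and \<gamma>: "\<gamma> > 0" and m_def: "m = nat \<lceil>\<gamma>\<rceil>"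
    and y: "continuous_on {a..b} y"
    and x: "\<And>t. t \<in> {a..b} \<Longrightarrow>
      x t = (\<Sum>i<m. c i * RL_integral a (real i) (\<lambda>_. 1) t) + RL_integral a \<gamma> y t"
begin

lemma m_bounds: "m \<ge> 1" "real m - 1 < \<gamma>" "\<gamma> \<le> real m"
  using \<gamma> unfolding m_def by linarith+

definition x_deriv :: "nat \<Rightarrow> real \<Rightarrow> real" where
  "x_deriv j t = (\<Sum>i\<in>{j..<m}. c i * RL_integral a (real i - real j) (\<lambda>_. 1) t) +
     RL_integral a (\<gamma> - real j) y t"

lemma x_deriv_0: "t \<in> {a..b} \<Longrightarrow> x t = x_deriv 0 t"
  by (simp add: x_deriv_def x lessThan_atLeast0)

text \<open>The bound j < m - 1 ensures \<gamma> - j \<ge> 1. One step further the order on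
  \<open>y\<close> would lie in (0,1], where for \<gamma> not an integer the derivative need not
  exist.\<close>

lemma x_deriv_has_derivative:
  assumes "j < m - 1" "t \<in> {a..b}"
  shows "(x_deriv j has_vector_derivative x_deriv (Suc j) t) (at t within {a..b})"
proof -
  have "{i \<in> {j..<m}. real i - real j \<noteq> 0} = {Suc j..<m}" by auto
  moreover have "\<gamma> - real j \<ge> 1" using assms(1) m_bounds by linarith
  moreover have "real i - real j \<ge> 1 \<or> real i - real j = 0" if "i \<in> {j..<m}" for i
    using that by (cases "i = j") auto
  ultimately show ?thesis
    using RL_combination_has_derivative[of "{j..<m}" "\<lambda>i. real i - real j" "\<gamma> - real j" a b y t c]
      assms y unfolding x_deriv_def[abs_def] by (simp add: algebra_simps)
qed

lemma deriv_within_x: "j < m \<Longrightarrow> t \<in> {a..b} \<Longrightarrow> deriv_within {a..b} j x t = x_deriv j t"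
  using x_deriv_0 x_deriv_has_derivative
  by (intro deriv_within_chain[OF ab, where n = "m - 1"]) auto

text \<open>At \<open>a\<close> every integral of positive order vanishes; only the term i = j, of
  order 0, survives.\<close>

lemma deriv_within_x_at_left_end:
  assumes "j < m"
  shows "deriv_within {a..b} j x a = c j"
proof -
  have "(\<Sum>i\<in>{j..<m}. c i * RL_integral a (real i - real j) (\<lambda>_. 1) a) =
      (\<Sum>i\<in>{j}. c i * RL_integral a (real i - real j) (\<lambda>_. 1) a)"
    using assms by (intro sum.mono_neutral_right) (auto intro!: RL_integral_at_left_end)
  moreover have "RL_integral a (\<gamma> - real j) y a = 0"
    using assms m_bounds by (intro RL_integral_at_left_end) linarith
  ultimately show ?thesis
    using assms ab by (simp add: deriv_within_x x_deriv_def)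
qed

lemma times_cont_differentiable_on_x:
  assumes "n < m"
  shows "times_cont_differentiable_on n x {a..b}"
  unfolding times_cont_differentiable_on_def
proof
  show "times_differentiable_on n x {a..b}"
    using assms x_deriv_0 x_deriv_has_derivative
    by (intro times_differentiable_on_chain[OF ab, where g = x_deriv]) auto
  have "continuous_on {a..b} (x_deriv n)"
    using assms m_bounds y unfolding x_deriv_def[abs_def]
    by (intro continuous_intros) auto
  then show "continuous_on {a..b} (deriv_within {a..b} n x)"
    using deriv_within_x[OF assms] by (rule continuous_on_eq[OF _ sym])
qed

context
  fixes \<beta> :: real and n :: nat
  assumes \<beta>: "0 < \<beta>" "\<beta> \<le> \<gamma>" and n_def: "n = nat \<lceil>\<beta>\<rceil>"
begin

lemma n_bounds: "n \<ge> 1" "real n - 1 < \<beta>" "\<beta> \<le> real n" "n \<le> m"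
  using \<beta>(1) nat_mono[OF ceiling_mono[OF \<beta>(2)]] unfolding n_def m_def by linarith+

definition RL_remainder_deriv :: "nat \<Rightarrow> real \<Rightarrow> real" where
  "RL_remainder_deriv j t =
     (\<Sum>i\<in>{n..<m}. c i * RL_integral a (real i + (real n - \<beta>) - real j) (\<lambda>_. 1) t) +
     RL_integral a (\<gamma> + (real n - \<beta>) - real j) y t"

lemma remainder_eq:
  assumes "t \<in> {a..b}"
  shows "x t - taylor_poly a b (n - 1) x t =
    (\<Sum>i\<in>{n..<m}. c i * RL_integral a (real i) (\<lambda>_. 1) t) + RL_integral a \<gamma> y t"
proof -
  have "{..n - 1} = {..<n}" using n_bounds by auto
  then have "taylor_poly a b (n - 1) x t = (\<Sum>i<n. c i * RL_integral a (real i) (\<lambda>_. 1) t)"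
    using n_bounds assms unfolding taylor_poly_def
    by (simp add: RL_integral_of_nat_1 deriv_within_x_at_left_end)
  moreover have "(\<Sum>i<m. c i * RL_integral a (real i) (\<lambda>_. 1) t) =
      (\<Sum>i<n. c i * RL_integral a (real i) (\<lambda>_. 1) t) +
      (\<Sum>i\<in>{n..<m}. c i * RL_integral a (real i) (\<lambda>_. 1) t)"
    using n_bounds by (simp add: lessThan_atLeast0 sum.atLeastLessThan_concat)
  ultimately show ?thesis using assms by (simp add: x)
qed

lemma RL_remainder_deriv_0:
  assumes t: "t \<in> {a..b}"
  shows "RL_integral a (real n - \<beta>) (\<lambda>t. x t - taylor_poly a b (n - 1) x t) t = RL_remainder_deriv 0 t"
proof -
  let ?\<delta> = "real n - \<beta>"
  have \<delta>: "?\<delta> \<ge> 0" using n_bounds by simp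
  have "RL_integral a ?\<delta> (\<lambda>t. x t - taylor_poly a b (n - 1) x t) t =
      RL_integral a ?\<delta> (\<lambda>t. (\<Sum>i\<in>{n..<m}. c i * RL_integral a (real i) (\<lambda>_. 1) t) + RL_integral a \<gamma> y t) t"
    using t by (intro RL_integral_cong remainder_eq) auto
  also have "\<dots> = (\<Sum>i\<in>{n..<m}. c i * RL_integral a ?\<delta> (RL_integral a (real i) (\<lambda>_. 1)) t) +
      RL_integral a ?\<delta> (RL_integral a \<gamma> y) t"
    using \<delta> t y \<gamma>
    by (subst RL_integral_add[where b = b], (auto intro!: continuous_intros)[4],
        subst RL_integral_sum[where b = b])
       (auto intro!: continuous_intros simp: RL_integral_mult)
  also have "\<dots> = RL_remainder_deriv 0 t"
    unfolding RL_remainder_deriv_def using \<delta> t y \<gamma>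
    by (simp add: RL_integral_RL_integral[where b = b] add.commute)
  finally show ?thesis .
qed

text \<open>Removing the Taylor polynomial leaves only monomials of degree i \<ge> n, and \<beta>
  \<le> \<gamma>. Hence all orders are at least 1 as long as j < n: each of the n differentiations
  just lowers them by 1, and no term is lost, unlike in \<open>x_deriv\<close>.\<close>

lemma RL_remainder_deriv_has_derivative:
  assumes "j < n" "t \<in> {a..b}"
  shows "(RL_remainder_deriv j has_vector_derivative RL_remainder_deriv (Suc j) t) (at t within {a..b})"
proof -
  have ge: "real i + (real n - \<beta>) - real j \<ge> 1" if "i \<in> {n..<m}" for i
    using that assms(1) n_bounds(3) by auto
  then have "{i \<in> {n..<m}. real i + (real n - \<beta>) - real j \<noteq> 0} = {n..<m}" by force
  moreover have "\<gamma> + (real n - \<beta>) - real j \<ge> 1"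
    using assms(1) \<beta>(2) by linarith
  ultimately show ?thesis
    using RL_combination_has_derivative[of "{n..<m}" "\<lambda>i. real i + (real n - \<beta>) - real j"
        "\<gamma> + (real n - \<beta>) - real j" a b y t c] assms y ge
    unfolding RL_remainder_deriv_def[abs_def] by (simp add: algebra_simps)
qed

lemma caputo_deriv_x:
  assumes "t \<in> {a..b}"
  shows "caputo_deriv a b \<beta> x t =
    (\<Sum>i\<in>{n..<m}. c i * RL_integral a (real i - \<beta>) (\<lambda>_. 1) t) + RL_integral a (\<gamma> - \<beta>) y t"
proof -
  have "caputo_deriv a b \<beta> x t = RL_remainder_deriv n t"
    unfolding caputo_deriv_def RL_deriv_def Let_def n_def[symmetric]
    using RL_remainder_deriv_0 RL_remainder_deriv_has_derivative assms
    by (intro deriv_within_chain[OF ab, where n = n]) auto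
  then show ?thesis by (simp add: RL_remainder_deriv_def algebra_simps)
qed

lemma caputo_differentiable_x: "caputo_differentiable a b \<beta> x"
  unfolding caputo_differentiable_def RL_differentiable_def Let_def n_def[symmetric]
proof
  show "times_cont_differentiable_on (n - 1) x {a..b}"
    using n_bounds by (intro times_cont_differentiable_on_x) auto
  show "times_differentiable_on n (RL_integral a (real n - \<beta>)
      (\<lambda>t. x t - taylor_poly a b (n - 1) x t)) {a..b}"
    using RL_remainder_deriv_0 RL_remainder_deriv_has_derivative
    by (intro times_differentiable_on_chain[OF ab, where g = RL_remainder_deriv]) auto
qed

end

text \<open>For \<beta> = \<gamma> the sum over \<open>{m..<m}\<close> is empty and the integral has
  order 0.\<close>

lemma caputo_deriv_x_top: "t \<in> {a..b} \<Longrightarrow> caputo_deriv a b \<gamma> x t = y t"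
  using caputo_deriv_x[OF \<gamma> order_refl m_def] by simp

lemma cont_caputo_differentiable_x: "cont_caputo_differentiable a b \<gamma> x"
  unfolding cont_caputo_differentiable_def
  using caputo_differentiable_x[OF \<gamma> order_refl m_def] continuous_on_eq[OF y sym[OF caputo_deriv_x_top]]
  by simp

end

section \<open>Recovering a function from its Caputo derivative\<close>

lemma RL_integral_const_0 [simp]: "RL_integral a p (\<lambda>_. 0) = (\<lambda>_. 0)"
  by (simp add: RL_integral_def fun_eq_iff)

text \<open>With \<delta> = m - \<gamma>, u the derivative of order m - 1 of \<open>x\<close> minus
  its Taylor polynomial, and J the fractional integral: the difference is J^(m-1) u, because its
  lower derivatives vanish at \<open>a\<close>. Abel inversion gives u = J^(1-\<delta>) y, so the
  difference is J^(m-1+1-\<delta>) y = J^\<gamma> y.\<close>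

lemma caputo_representation_of_derivative:
  assumes "a < b" "\<gamma> > 0" "cont_caputo_differentiable a b \<gamma> x"
  shows "caputo_representation a b \<gamma> (\<lambda>i. deriv_within {a..b} i x a) (caputo_deriv a b \<gamma> x) x (nat \<lceil>\<gamma>\<rceil>)"
proof
  define m where "m = nat \<lceil>\<gamma>\<rceil>"
  define c where "c i = deriv_within {a..b} i x a" for i
  define y where "y = caputo_deriv a b \<gamma> x"
  define h where "h = RL_integral a (real m - \<gamma>) (\<lambda>t. x t - taylor_poly a b (m - 1) x t)"
  define \<delta> where "\<delta> = real m - \<gamma>"
  have m: "m \<ge> 1" "real m - 1 < \<gamma>" "\<gamma> \<le> real m"
    using \<open>\<gamma> > 0\<close> unfolding m_def by linarith+
  then have \<delta>: "0 \<le> \<delta>" "\<delta> < 1" by (auto simp: \<delta>_def)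
  have x: "times_differentiable_on (m - 1) x {a..b}" "continuous_on {a..b} (deriv_within {a..b} (m - 1) x)"
    and h: "times_differentiable_on m h {a..b}" and y: "continuous_on {a..b} y"
    using assms(3)
    unfolding cont_caputo_differentiable_def caputo_differentiable_def RL_differentiable_def
      times_cont_differentiable_on_def Let_def m_def[symmetric] h_def[symmetric] y_def[symmetric] by auto
  have y_h: "y = deriv_within {a..b} m h"
    by (simp add: y_def caputo_deriv_def RL_deriv_def Let_def h_def m_def)
  show "continuous_on {a..b} (caputo_deriv a b \<gamma> x)" using y by (simp add: y_def)
  \<comment> \<open>\<open>T j\<close> is the j-th derivative of the Taylor polynomial, and for j <
    m \<open>g j\<close> is that of the remainder; \<open>u\<close> is the last one known to
    exist.\<close>
  define T where "T j t = (\<Sum>i\<in>{j..<m}. c i * RL_integral a (real i - real j) (\<lambda>_. 1) t)" for j t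
  define g where "g j t = deriv_within {a..b} j x t - T j t" for j t
  define u where "u = g (m - 1)"
  have T_cont: "continuous_on {a..b} (T j)" for j
    unfolding T_def[abs_def] by (intro continuous_intros) auto
  have T_der: "(T j has_vector_derivative T (Suc j) t) (at t within {a..b})"
    if "t \<in> {a..b}" for j t
  proof -
    have "{i \<in> {j..<m}. real i - real j \<noteq> 0} = {Suc j..<m}" by auto
    moreover have "real i - real j \<ge> 1 \<or> real i - real j = 0" if "i \<in> {j..<m}" for i
      using that by (cases "i = j") auto
    ultimately show ?thesis
      \<comment> \<open>The fractional part is switched off by taking the zero function with order
        1.\<close>
      using RL_combination_has_derivative[of "{j..<m}" "\<lambda>i. real i - real j" 1 a b "\<lambda>_. 0" t c] that
      unfolding T_def[abs_def] by (simp add: algebra_simps)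
  qed
  have g_der: "(g j has_vector_derivative g (Suc j) t) (at t within {a..b})"
    if "j < m - 1" "t \<in> {a..b}" for j t
    unfolding g_def[abs_def] using that
    by (intro has_vector_derivative_diff T_der times_differentiable_on_deriv[OF x(1)])
  have g_a: "g j a = 0" if "j < m" for j
  proof -
    have "T j a = (\<Sum>i\<in>{j}. c i * RL_integral a (real i - real j) (\<lambda>_. 1) a)"
      unfolding T_def using that
      by (intro sum.mono_neutral_right) (auto intro!: RL_integral_at_left_end)
    then show ?thesis by (simp add: g_def c_def)
  qed
  have u: "continuous_on {a..b} u"
    unfolding u_def g_def[abs_def] by (intro continuous_intros x T_cont)
  have g_u: "g (m - 1 - k) t = RL_integral a (real k) u t" if "k \<le> m - 1" "t \<in> {a..b}" for k t
    using that
  proof (induction k arbitrary: t)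
    case (Suc k)
    define j where "j = m - 1 - Suc k"
    have j: "j < m - 1" "Suc j = m - 1 - k" using Suc.prems m by (auto simp: j_def)
    have "(g j has_vector_derivative RL_integral a (real k) u t) (at t within {a..b})"
      if "t \<in> {a..b}" for t
      using g_der[OF j(1) that] Suc.IH[of t] Suc.prems that by (simp add: j(2))
    then have "RL_integral a 1 (RL_integral a (real k) u) t = g j t - g j a"
      using Suc.prems u by (intro RL_integral_1_derivative continuous_on_RL_integral) auto
    then show ?case
      using Suc.prems u g_a[of j] j by (simp add: RL_integral_RL_integral[where b = b] j_def)
  qed (simp add: u_def)
  have taylor: "x t - taylor_poly a b (m - 1) x t = g 0 t" if "t \<in> {a..b}" for t
  proof -
    have "{..m - 1} = {0..<m}" using m by auto
    then show ?thesis using that by (simp add: g_def T_def taylor_poly_def RL_integral_of_nat_1 c_def)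
  qed
  have g_0: "g 0 t = RL_integral a (real (m - 1)) u t" if "t \<in> {a..b}" for t
    using g_u[of "m - 1" t] that by simp
  have h_u: "h t = RL_integral a (real (m - 1) - real 0 + \<delta>) u t" if t: "t \<in> {a..b}" for t
  proof -
    have "h t = RL_integral a \<delta> (RL_integral a (real (m - 1)) u) t"
      unfolding h_def \<delta>_def[symmetric] using t by (intro RL_integral_cong trans[OF taylor g_0]) auto
    then show ?thesis using t u \<delta> by (simp add: RL_integral_RL_integral[where b = b] add.commute)
  qed
  have h_top: "deriv_within {a..b} (m - 1) h t = RL_integral a \<delta> u t" if t: "t \<in> {a..b}" for t
  proof -
    have "(RL_integral a (real (m - 1) - real j + \<delta>) u has_vector_derivative
        RL_integral a (real (m - 1) - real (Suc j) + \<delta>) u t) (at t within {a..b})"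
      if "j < m - 1" "t \<in> {a..b}" for j t
      using RL_integral_has_derivative[of "real (m - 1) - real j + \<delta>" a b u t] that u \<delta>
      by (simp add: algebra_simps)
    from deriv_within_chain[OF \<open>a < b\<close> h_u this order_refl t] show ?thesis by simp
  qed
  have "(RL_integral a \<delta> u has_vector_derivative y t) (at t within {a..b})" if t: "t \<in> {a..b}" for t
  proof -
    have "(deriv_within {a..b} (m - 1) h has_vector_derivative y t) (at t within {a..b})"
      using times_differentiable_on_deriv[OF h, of "m - 1" t] t m by (simp add: y_h)
    then show ?thesis
      using has_vector_derivative_cong_on[of "{a..b}" _ "RL_integral a \<delta> u" t, OF h_top t] by simp
  qed
  \<comment> \<open>This removes the constant of integration. For \<delta> = 0, that is for integer
    \<gamma>, it is the vanishing of \<open>u\<close> itself at \<open>a\<close>.\<close>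
  moreover have "RL_integral a \<delta> u a = 0"
    using g_a[of "m - 1"] m by (cases "\<delta> = 0") (auto simp: u_def RL_integral_at_left_end)
  ultimately have J1y: "RL_integral a 1 y t = RL_integral a \<delta> u t" if "t \<in> {a..b}" for t
    using RL_integral_1_derivative[OF y, of "RL_integral a \<delta> u" t] that by simp
  \<comment> \<open>The candidate for \<open>u\<close>: applying the integral of order 1 - \<delta>
    > 0 to \<open>J1y\<close> turns the left side into the integral of order 1 of \<open>v\<close>
    and the right side into that of \<open>u\<close>.\<close>
  define v where "v = RL_integral a (1 - \<delta>) y"
  have v: "continuous_on {a..b} v" unfolding v_def using \<delta> y by (intro continuous_on_RL_integral) auto
  have J1u: "RL_integral a 1 u t = RL_integral a 1 v t" if t: "t \<in> {a..b}" for t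
  proof -
    have "RL_integral a 1 u t = RL_integral a (1 - \<delta>) (RL_integral a \<delta> u) t"
      using \<delta> u t by (simp add: RL_integral_RL_integral[where b = b])
    also have "\<dots> = RL_integral a (1 - \<delta>) (RL_integral a 1 y) t"
      using t by (intro RL_integral_cong) (auto simp: J1y)
    also have "\<dots> = RL_integral a 1 v t"
      unfolding v_def using \<delta> y t by (simp add: RL_integral_RL_integral[where b = b] algebra_simps)
    finally show ?thesis .
  qed
  have u_v: "u t = v t" if t: "t \<in> {a..b}" for t
  proof -
    have "(RL_integral a 1 u has_vector_derivative u t) (at t within {a..b})"
      "(RL_integral a 1 v has_vector_derivative v t) (at t within {a..b})"
      using RL_integral_has_derivative[of 1 a b] u v t by force+
    moreover note has_vector_derivative_cong_on[of "{a..b}" _ "RL_integral a 1 v" t "v t", OF J1u t]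
    ultimately show ?thesis
      using vector_derivative_unique_within_closed_interval[of a b t "RL_integral a 1 u"] \<open>a < b\<close> t
      by simp
  qed
  fix t assume t: "t \<in> {a..b}"
  have "x t = T 0 t + g 0 t" by (simp add: g_def)
  also have "g 0 t = RL_integral a (real (m - 1)) v t"
    using t unfolding g_0[OF t] by (intro RL_integral_cong) (auto simp: u_v)
  also have "\<dots> = RL_integral a (real (m - 1) + (1 - \<delta>)) y t"
    unfolding v_def using t y \<delta> by (intro RL_integral_RL_integral) auto
  also have "real (m - 1) + (1 - \<delta>) = \<gamma>" using m by (simp add: \<delta>_def of_nat_diff)
  finally show "x t = (\<Sum>i<nat \<lceil>\<gamma>\<rceil>. deriv_within {a..b} i x a * RL_integral a (real i) (\<lambda>_. 1) t) +
      RL_integral a \<gamma> (caputo_deriv a b \<gamma> x) t"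
    by (simp add: T_def c_def m_def y_def lessThan_atLeast0)
qed (use assms in auto)

section \<open>Fixed points in weighted norms\<close>

text \<open>The factor by which \<open>RL_integral a \<beta>\<close> contracts the norm weighted by \<open>exp (- \<omega> * t)\<close>.\<close>

definition RL_weight :: "real \<Rightarrow> real \<Rightarrow> real \<Rightarrow> real" where
  "RL_weight l \<beta> \<omega> = 1 / Gamma \<beta> * (\<integral>u. indicator {0..l} u * u powr (\<beta> - 1) * exp (- \<omega> * u) \<partial>lborel)"

lemma RL_weight_nonneg: "\<beta> > 0 \<Longrightarrow> RL_weight l \<beta> \<omega> \<ge> 0"
  unfolding RL_weight_def
  by (intro mult_nonneg_nonneg integral_nonneg_AE AE_I2) (auto simp: Gamma_real_pos less_imp_le)

lemma integrable_RL_weight: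
  fixes \<beta> \<omega> l :: real
  assumes "\<beta> > 0" "\<omega> \<ge> 0"
  shows "integrable lborel (\<lambda>u. indicator {0..l} u * u powr (\<beta> - 1) * exp (- \<omega> * u))"
proof (rule Bochner_Integration.integrable_bound[OF integrable_powr_kernel[OF assms(1), of l]])
  show "AE u in lborel. norm (indicator {0..l} u * u powr (\<beta> - 1) * exp (- \<omega> * u))
      \<le> norm (indicator {0..l} u * u powr (\<beta> - 1))"
    using assms by (intro AE_I2) (auto simp: indicator_def abs_mult mult_left_le)
qed measurable

text \<open>The exponential tends to 0 at each u > 0 and the unweighted kernel dominates. Integer
  values of \<omega> suffice, since only one large value is wanted.\<close>

lemma RL_weight_tendsto_0:
  assumes "\<beta> > 0"
  shows "(\<lambda>n. RL_weight l \<beta> (real n)) \<longlonglongrightarrow> 0"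
proof -
  have "(\<lambda>n. \<integral>u. indicator {0..l} u * u powr (\<beta> - 1) * exp (- real n * u) \<partial>lborel) \<longlonglongrightarrow> integral\<^sup>L (lborel :: real measure) (\<lambda>_. 0)"
  proof (rule integral_dominated_convergence[OF _ _ integrable_powr_kernel[OF assms, of l]])
    show "AE u in lborel. (\<lambda>n. indicator {0..l} u * u powr (\<beta> - 1) * exp (- real n * u)) \<longlonglongrightarrow> 0"
      using AE_lborel_singleton[of 0]
    proof eventually_elim
      case (elim u)
      have "(\<lambda>n. exp (- u) ^ n) \<longlonglongrightarrow> 0" if "u > 0"
        using that by (intro LIMSEQ_power_zero) auto
      then have "(\<lambda>n. exp (- real n * u)) \<longlonglongrightarrow> 0" if "u > 0"
        using that by (simp add: exp_of_nat_mult[symmetric])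
      then show ?case
        using elim by (cases "u \<in> {0..l}") (auto intro!: tendsto_mult_right_zero)
    qed
    show "AE u in lborel. norm (indicator {0..l} u * u powr (\<beta> - 1) * exp (- real n * u))
        \<le> indicator {0..l} u * u powr (\<beta> - 1)" for n
      by (intro AE_I2) (auto simp: indicator_def abs_mult mult_left_le)
  qed measurable
  from tendsto_mult_left[OF this, of "1 / Gamma \<beta>"] show ?thesis
    by (simp add: RL_weight_def)
qed

text \<open>In convolution form |y (t - u)| \<le> M exp (\<omega> t) exp (- \<omega> u), and the
  last factor is absorbed into \<open>RL_weight\<close>. Integrating over all of
  \<open>{0..b - a}\<close> makes the constant independent of t.\<close>

lemma RL_integral_weighted_bound:
  assumes "\<beta> > 0" "\<omega> \<ge> 0" "continuous_on {a..b} y" "t \<in> {a..b}"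
    and bound: "\<And>t. t \<in> {a..b} \<Longrightarrow> \<bar>y t\<bar> \<le> M * exp (\<omega> * t)"
  shows "\<bar>RL_integral a \<beta> y t\<bar> \<le> RL_weight (b - a) \<beta> \<omega> * M * exp (\<omega> * t)"
proof -
  have "0 \<le> M * exp (\<omega> * t)" using bound[OF assms(4)] by linarith
  then have M: "M \<ge> 0" by (simp add: zero_le_mult_iff)
  define k where "k = (\<lambda>u. indicator {0..b - a} u * u powr (\<beta> - 1) * (indicator {a..b} (t - u) * y (t - u)))"
  obtain B where B: "B \<ge> 0" "\<And>t. t \<in> {a..b} \<Longrightarrow> \<bar>y t\<bar> \<le> B"
    using continuous_on_Icc_bounded[OF assms(3)] by blast
  have k_int: "integrable lborel k"
    unfolding k_def using B
    by (intro integrable_powr_kernel_mult[where M = B and Y = "\<lambda>t. indicator {a..b} t * y t"]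
          assms measurable_indicator_mult) (auto simp: indicator_def)
  have "\<bar>\<integral>u. k u \<partial>lborel\<bar> \<le> (\<integral>u. \<bar>k u\<bar> \<partial>lborel)"
    by (rule integral_abs_bound)
  also have "\<dots> \<le> (\<integral>u. (M * exp (\<omega> * t)) * (indicator {0..b - a} u * u powr (\<beta> - 1) * exp (- \<omega> * u)) \<partial>lborel)"
  proof (rule integral_mono)
    show "integrable lborel (\<lambda>u. \<bar>k u\<bar>)" using k_int by simp
    show "integrable lborel (\<lambda>u. (M * exp (\<omega> * t)) * (indicator {0..b - a} u * u powr (\<beta> - 1) * exp (- \<omega> * u)))"
      using assms by (intro integrable_mult_right integrable_RL_weight)
    fix u :: real
    have "\<bar>indicator {a..b} (t - u) * y (t - u)\<bar> \<le> M * exp (\<omega> * (t - u))"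
      using bound[of "t - u"] M by (auto simp: indicator_def)
    also have "\<dots> = (M * exp (\<omega> * t)) * exp (- \<omega> * u)"
      by (simp add: exp_add[symmetric] algebra_simps)
    finally have "(indicator {0..b - a} u * u powr (\<beta> - 1)) * \<bar>indicator {a..b} (t - u) * y (t - u)\<bar> \<le>
        (indicator {0..b - a} u * u powr (\<beta> - 1)) * ((M * exp (\<omega> * t)) * exp (- \<omega> * u))"
      by (intro mult_left_mono) auto
    then show "\<bar>k u\<bar> \<le> (M * exp (\<omega> * t)) * (indicator {0..b - a} u * u powr (\<beta> - 1) * exp (- \<omega> * u))"
      by (simp add: k_def abs_mult mult_ac)
  qed
  finally have "1 / Gamma \<beta> * \<bar>\<integral>u. k u \<partial>lborel\<bar> \<le> 1 / Gamma \<beta> *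
      ((M * exp (\<omega> * t)) * (\<integral>u. indicator {0..b - a} u * u powr (\<beta> - 1) * exp (- \<omega> * u) \<partial>lborel))"
    using assms(1) by (intro mult_left_mono) (auto simp: less_imp_le Gamma_real_pos)
  moreover have "\<bar>RL_integral a \<beta> y t\<bar> = 1 / Gamma \<beta> * \<bar>\<integral>u. k u \<partial>lborel\<bar>"
    using assms(1) unfolding RL_integral_eq_convolution[OF assms(1,4)] k_def[symmetric]
    by (simp add: abs_mult Gamma_real_pos less_imp_le)
  ultimately show ?thesis by (simp add: RL_weight_def mult_ac)
qed

section \<open>Contractions and their fixed points\<close>

text \<open>The Lipschitz condition for the weighted supremum norm, phrased through arbitrary bounds
  M so that no supremum has to be formed.\<close>

definition weighted_contraction ::
    "real \<Rightarrow> real \<Rightarrow> real set \<Rightarrow> ((real \<Rightarrow> real) \<Rightarrow> real \<Rightarrow> real) \<Rightarrow> bool" where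
  "weighted_contraction q \<omega> S F \<longleftrightarrow> (\<forall>y z M. continuous_on S y \<longrightarrow> continuous_on S z \<longrightarrow>
     (\<forall>t\<in>S. \<bar>y t - z t\<bar> \<le> M * exp (\<omega> * t)) \<longrightarrow>
     (\<forall>t\<in>S. \<bar>F y t - F z t\<bar> \<le> q * M * exp (\<omega> * t)))"

lemma weighted_contractionD:
  assumes "weighted_contraction q \<omega> S F" "continuous_on S y" "continuous_on S z"
    "\<And>t. t \<in> S \<Longrightarrow> \<bar>y t - z t\<bar> \<le> M * exp (\<omega> * t)" "t \<in> S"
  shows "\<bar>F y t - F z t\<bar> \<le> q * M * exp (\<omega> * t)"
  using assms unfolding weighted_contraction_def by blast

text \<open>Banach's theorem in the complete space of bounded continuous functions on the real line.
  Dividing by \<open>exp (\<omega> * t)\<close> turns the weighted norm into the ordinary supremum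
  distance.\<close>

lemma weighted_contraction_fixed_point:
  fixes F :: "(real \<Rightarrow> real) \<Rightarrow> real \<Rightarrow> real"
  assumes "a < b" "0 \<le> q" "q < 1"
    and cont: "\<And>y. continuous_on {a..b} y \<Longrightarrow> continuous_on {a..b} (F y)"
    and contr: "weighted_contraction q \<omega> {a..b} F"
  shows "\<exists>y. continuous_on {a..b} y \<and> (\<forall>t\<in>{a..b}. y t = F y t)"
proof -
  define E where "E w = (\<lambda>t. exp (\<omega> * t) * apply_bcontfun w t)" for w
  have E_cont: "continuous_on {a..b} (E w)" for w
    unfolding E_def by (intro continuous_intros continuous_on_apply_bcontfun)
  \<comment> \<open>The image is \<open>F\<close> conjugated by the weight; \<open>clamp\<close>
    extends it constantly beyond \<open>a\<close> and \<open>b\<close>, which keeps it continuous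
    and bounded.\<close>
  have "\<exists>g. \<forall>s. apply_bcontfun g s = exp (- \<omega> * clamp a b s) * F (E w) (clamp a b s)" for w
  proof -
    have "continuous_on (cbox a b) (\<lambda>t. exp (- \<omega> * t) * F (E w) t)"
      using cont[OF E_cont] by (auto intro!: continuous_intros)
    then show ?thesis by (rule continuous_on_cbox_bcontfunE) blast
  qed
  then obtain G where G: "\<And>w s. apply_bcontfun (G w) s = exp (- \<omega> * clamp a b s) * F (E w) (clamp a b s)"
    by metis
  have clamp: "clamp a b s \<in> {a..b}" for s :: real
    using clamp_in_interval[of a b s] \<open>a < b\<close> by simp
  have "dist (G v) (G w) \<le> q * dist v w" for v w
  proof (rule dist_bound)
    fix s
    define t where "t = clamp a b s"
    have t: "t \<in> {a..b}" unfolding t_def by (rule clamp)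
    have "\<bar>E v t - E w t\<bar> \<le> dist v w * exp (\<omega> * t)" for t
    proof -
      have "\<bar>E v t - E w t\<bar> = dist (apply_bcontfun v t) (apply_bcontfun w t) * exp (\<omega> * t)"
        unfolding E_def right_diff_distrib[symmetric] by (simp add: abs_mult dist_real_def)
      then show ?thesis using dist_bounded[of v t w] by (simp add: mult_right_mono)
    qed
    then have "\<bar>F (E v) t - F (E w) t\<bar> \<le> q * dist v w * exp (\<omega> * t)"
      by (intro weighted_contractionD[OF contr] E_cont t)
    then have "exp (- \<omega> * t) * \<bar>F (E v) t - F (E w) t\<bar> \<le> exp (- \<omega> * t) * (q * dist v w * exp (\<omega> * t))"
      by (intro mult_left_mono) auto
    also have "\<dots> = q * dist v w" by (simp add: exp_minus field_simps)
    finally show "dist (apply_bcontfun (G v) s) (apply_bcontfun (G w) s) \<le> q * dist v w"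
      by (simp add: G t_def[symmetric] dist_real_def right_diff_distrib[symmetric] abs_mult)
  qed
  then obtain w where w: "G w = w"
    using banach_fix_type[OF assms(2,3), of G] by blast
  show ?thesis
  proof (intro exI conjI ballI)
    fix t assume t: "t \<in> {a..b}"
    then have "clamp a b t = t" by (simp add: clamp_cancel_cbox)
    then show "E w t = F (E w) t"
      using G[of w t] by (simp add: w E_def exp_minus field_simps)
  qed (rule E_cont)
qed

text \<open>Applying the contraction n times bounds the difference of two fixed points by
  \<open>q ^ n * M * exp (\<omega> * t)\<close>, which tends to 0. The initial M exists because the
  weighted difference is continuous on a compact interval.\<close>

lemma weighted_contraction_fixed_point_unique:
  fixes F :: "(real \<Rightarrow> real) \<Rightarrow> real \<Rightarrow> real"
  assumes "0 \<le> q" "q < 1"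
    and contr: "weighted_contraction q \<omega> {a..b} F"
    and y: "continuous_on {a..b} y" "\<And>t. t \<in> {a..b} \<Longrightarrow> y t = F y t"
    and z: "continuous_on {a..b} z" "\<And>t. t \<in> {a..b} \<Longrightarrow> z t = F z t"
    and t: "t \<in> {a..b}"
  shows "y t = z t"
proof -
  have "continuous_on {a..b} (\<lambda>t. (y t - z t) * exp (- \<omega> * t))"
    by (intro continuous_intros y z)
  then obtain M where M: "\<And>t. t \<in> {a..b} \<Longrightarrow> \<bar>(y t - z t) * exp (- \<omega> * t)\<bar> \<le> M"
    using continuous_on_Icc_bounded by blast
  have "\<forall>t\<in>{a..b}. \<bar>y t - z t\<bar> \<le> q ^ n * M * exp (\<omega> * t)" for n
  proof (induction n)
    case 0
    show ?case
      using M by (auto simp: abs_mult exp_minus field_simps)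
  next
    case (Suc n)
    show ?case
    proof
      fix t assume t: "t \<in> {a..b}"
      have "\<bar>F y t - F z t\<bar> \<le> q * (q ^ n * M) * exp (\<omega> * t)"
        using Suc by (intro weighted_contractionD[OF contr] y z t) auto
      then show "\<bar>y t - z t\<bar> \<le> q ^ Suc n * M * exp (\<omega> * t)"
        using y(2)[OF t] z(2)[OF t] by (simp add: mult_ac)
    qed
  qed
  moreover have "(\<lambda>n. q ^ n * M * exp (\<omega> * t)) \<longlonglongrightarrow> 0 * M * exp (\<omega> * t)"
    using assms(1,2) by (intro tendsto_intros LIMSEQ_power_zero) auto
  ultimately have "\<bar>y t - z t\<bar> \<le> 0 * M * exp (\<omega> * t)"
    using t by (intro LIMSEQ_le_const[of _ _ "\<bar>y t - z t\<bar>"]) blast+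
  then show ?thesis by simp
qed

section \<open>The fixed point equation for the highest derivative\<close>

text \<open>\<open>Euclidean_space k\<close> carries the subspace topology of a product, so
  continuity into it is coordinatewise.\<close>

lemma continuous_on_Euclidean_space_compose:
  assumes "continuous_map (prod_topology (top_of_set S) (Euclidean_space k)) euclideanreal f"
    and "\<And>i. i < k \<Longrightarrow> continuous_on S (\<lambda>t. v t i)" "\<And>t i. t \<in> S \<Longrightarrow> i \<ge> k \<Longrightarrow> v t i = 0"
  shows "continuous_on S (\<lambda>t. f (t, v t))"
proof -
  have "continuous_on S (\<lambda>t. v t i)" for i
  proof (cases "i < k")
    case False
    then show ?thesis using assms(3) by (auto intro: continuous_on_eq[OF continuous_on_const, of _ 0])
  qed (use assms(2) in simp)
  then have "continuous_map (top_of_set S) (Euclidean_space k) v"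
    using assms(3)
    by (auto simp: Euclidean_space_def continuous_map_in_subtopology continuous_map_componentwise_UNIV)
  then have "continuous_map (top_of_set S) (prod_topology (top_of_set S) (Euclidean_space k)) (\<lambda>t. (t, v t))"
    by (intro continuous_map_pairedI) auto
  from continuous_map_compose[OF this assms(1)] show ?thesis by (simp add: comp_def)
qed

text \<open>Isolates the integral equation from Caputo derivatives: \<open>A i\<close> is the part
  of the i-th argument fixed by the initial values, and \<open>\<beta> i\<close> is the order gap
  between the top derivative and that argument.\<close>

locale volterra_system =
  fixes a b :: real and k :: nat and \<beta> :: "nat \<Rightarrow> real" and A :: "nat \<Rightarrow> real \<Rightarrow> real"
    and f :: "real \<times> (nat \<Rightarrow> real) \<Rightarrow> real" and L :: real
  assumes ab: "a < b" and \<beta>: "\<And>i. i < k \<Longrightarrow> \<beta> i > 0" and L: "L > 0"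
    and A: "\<And>i. i < k \<Longrightarrow> continuous_on {a..b} (A i)"
    and f: "continuous_map (prod_topology (top_of_set {a..b}) (Euclidean_space k)) euclideanreal f"
    and lipschitz: "\<And>t y z. t \<in> {a..b} \<Longrightarrow> y \<in> topspace (Euclidean_space k) \<Longrightarrow>
      z \<in> topspace (Euclidean_space k) \<Longrightarrow> \<bar>f (t, y) - f (t, z)\<bar> \<le> L * L2_set (\<lambda>i. y i - z i) {..<k}"
begin

definition arg :: "(real \<Rightarrow> real) \<Rightarrow> real \<Rightarrow> nat \<Rightarrow> real" where
  "arg y t = (\<lambda>i. if i < k then A i t + RL_integral a (\<beta> i) y t else 0)"

definition F :: "(real \<Rightarrow> real) \<Rightarrow> real \<Rightarrow> real" where
  "F y t = f (t, arg y t)"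

lemma continuous_on_F:
  assumes "continuous_on {a..b} y"
  shows "continuous_on {a..b} (F y)"
  unfolding F_def
proof (rule continuous_on_Euclidean_space_compose[OF f])
  fix i assume i: "i < k"
  then show "continuous_on {a..b} (\<lambda>t. arg y t i)"
    using A[OF i] \<beta>[OF i] assms by (auto simp: arg_def intro!: continuous_intros)
qed (simp add: arg_def)

text \<open>The parts \<open>A i\<close> cancel in the difference. Bounding the Euclidean norm by
  the sum of absolute values lets each integral be estimated by its own weight.\<close>

lemma F_weighted_bound:
  assumes "\<omega> \<ge> 0" and y: "continuous_on {a..b} y" and z: "continuous_on {a..b} z"
    and bound: "\<And>t. t \<in> {a..b} \<Longrightarrow> \<bar>y t - z t\<bar> \<le> M * exp (\<omega> * t)" and t: "t \<in> {a..b}"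
  shows "\<bar>F y t - F z t\<bar> \<le> L * (\<Sum>i<k. RL_weight (b - a) (\<beta> i) \<omega>) * M * exp (\<omega> * t)"
proof -
  have "\<bar>F y t - F z t\<bar> \<le> L * L2_set (\<lambda>i. arg y t i - arg z t i) {..<k}"
    unfolding F_def by (rule lipschitz[OF t]) (auto simp: topspace_Euclidean_space arg_def)
  also have "\<dots> \<le> L * (\<Sum>i<k. \<bar>arg y t i - arg z t i\<bar>)"
    using L by (intro mult_left_mono L2_set_le_sum_abs) auto
  also have "\<dots> \<le> L * (\<Sum>i<k. RL_weight (b - a) (\<beta> i) \<omega> * M * exp (\<omega> * t))"
  proof (intro mult_left_mono sum_mono)
    fix i assume "i \<in> {..<k}"
    then have i: "i < k" by simp
    have "\<bar>RL_integral a (\<beta> i) (\<lambda>t. y t - z t) t\<bar> \<le> RL_weight (b - a) (\<beta> i) \<omega> * M * exp (\<omega> * t)"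
      using \<beta>[OF i] assms by (intro RL_integral_weighted_bound continuous_intros) auto
    then show "\<bar>arg y t i - arg z t i\<bar> \<le> RL_weight (b - a) (\<beta> i) \<omega> * M * exp (\<omega> * t)"
      using \<beta>[OF i] y z t i by (simp add: arg_def RL_integral_diff[where b = b])
  qed (use L in simp)
  also have "\<dots> = L * (\<Sum>i<k. RL_weight (b - a) (\<beta> i) \<omega>) * M * exp (\<omega> * t)"
    by (simp add: sum_distrib_right mult.assoc)
  finally show ?thesis .
qed

text \<open>The factor q is L times a finite sum of weights, each tending to 0, so it drops below 1
  for large \<omega>.\<close>

lemma ex_weighted_contraction:
  obtains q \<omega> where "0 \<le> q" "q < 1" "weighted_contraction q \<omega> {a..b} F"
proof -
  have "(\<lambda>n. L * (\<Sum>i<k. RL_weight (b - a) (\<beta> i) (real n))) \<longlonglongrightarrow> L * (\<Sum>i<k. 0)"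
    using \<beta> by (intro tendsto_intros RL_weight_tendsto_0) auto
  then have "\<forall>\<^sub>F n in sequentially. L * (\<Sum>i<k. RL_weight (b - a) (\<beta> i) (real n)) < 1"
    by (intro order_tendstoD(2)[where y = 0]) auto
  then obtain n where n: "L * (\<Sum>i<k. RL_weight (b - a) (\<beta> i) (real n)) < 1"
    by (auto dest: eventually_happens)
  show ?thesis
  proof (rule that[where \<omega> = "real n", OF _ n])
    show "0 \<le> L * (\<Sum>i<k. RL_weight (b - a) (\<beta> i) (real n))"
      using L \<beta> by (intro mult_nonneg_nonneg sum_nonneg RL_weight_nonneg) auto
    show "weighted_contraction (L * (\<Sum>i<k. RL_weight (b - a) (\<beta> i) (real n))) (real n) {a..b} F"
      unfolding weighted_contraction_def by (intro allI impI ballI F_weighted_bound) auto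
  qed
qed

lemma ex_fixed_point: "\<exists>y. continuous_on {a..b} y \<and> (\<forall>t\<in>{a..b}. y t = F y t)"
  by (rule ex_weighted_contraction) (rule weighted_contraction_fixed_point[OF ab _ _ continuous_on_F])

lemma fixed_point_unique:
  assumes "continuous_on {a..b} y" "\<And>t. t \<in> {a..b} \<Longrightarrow> y t = F y t"
    and "continuous_on {a..b} z" "\<And>t. t \<in> {a..b} \<Longrightarrow> z t = F z t" "t \<in> {a..b}"
  shows "y t = z t"
  by (rule ex_weighted_contraction) (rule weighted_contraction_fixed_point_unique[OF _ _ _ assms])

end

section \<open>The initial value problem\<close>

text \<open>The equation determines \<open>x\<close> only on \<open>{a..b}\<close>; membership in
  \<open>extensional {a..b}\<close> fixes its values elsewhere, so that uniqueness becomes equality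
  of functions.\<close>

theorem theorem17:
  fixes a b :: real and k :: nat and \<alpha> :: "nat \<Rightarrow> real"
    and f :: "real \<times> (nat \<Rightarrow> real) \<Rightarrow> real" and x\<^sub>a :: "nat \<Rightarrow> real"
  assumes "a < b"
    and "k \<ge> 1"
    and "0 < \<alpha> 1" and "\<alpha> 1 \<le> 1"
    and "\<forall>j\<in>{2..k}. \<alpha> (j - 1) < \<alpha> j \<and> \<alpha> j - \<alpha> (j - 1) \<le> 1"
    and "continuous_map (prod_topology (top_of_set {a..b}) (Euclidean_space k)) euclideanreal f"
    and "\<exists>L>0. \<forall>t\<in>{a..b}. \<forall>y\<in>topspace (Euclidean_space k). \<forall>z\<in>topspace (Euclidean_space k).
           \<bar>f (t, y) - f (t, z)\<bar> \<le> L * L2_set (\<lambda>i. y i - z i) {..<k}"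
  shows "\<exists>!x. x \<in> extensional {a..b} \<and> multi_term_solution a b k \<alpha> f x \<and>
           (\<forall>j<nat \<lceil>\<alpha> k\<rceil>. deriv_within {a..b} j x a = x\<^sub>a j)"
proof -
  obtain L where L: "L > 0" "\<forall>t\<in>{a..b}. \<forall>y\<in>topspace (Euclidean_space k). \<forall>z\<in>topspace (Euclidean_space k).
           \<bar>f (t, y) - f (t, z)\<bar> \<le> L * L2_set (\<lambda>i. y i - z i) {..<k}"
    using assms(7) by blast
  have step: "\<alpha> j < \<alpha> (Suc j)" if "1 \<le> j" "j < k" for j
    using assms(5)[rule_format, of "Suc j"] that by simp
  have mono: "\<alpha> i < \<alpha> j" if "1 \<le> i" "i < j" "j \<le> k" for i j
    using that(2,3)
  proof (induction j)
    case (Suc j)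
    then show ?case using step[of j] that(1) by (cases "i = j") auto
  qed simp
  have \<alpha>_pos: "\<alpha> i > 0" if "1 \<le> i" "i \<le> k" for i
    using mono[of 1 i] that assms(3) by (cases "i = 1") auto
  define \<gamma> m where "\<gamma> = \<alpha> k" and "m = nat \<lceil>\<gamma>\<rceil>"
  have \<gamma>: "\<gamma> > 0" using \<alpha>_pos[of k] assms(2) by (simp add: \<gamma>_def)
  \<comment> \<open>Argument 0 is \<open>x\<close> itself, treated as a derivative of order 0.
    Accordingly \<open>A 0\<close> is the Taylor polynomial, and for 0 < i < k \<open>A i\<close> is
    its Caputo derivative of order \<open>\<alpha> i\<close>, which annihilates the monomials of
    degree below the ceiling.\<close>
  define \<beta> where "\<beta> i = \<gamma> - (if i = 0 then 0 else \<alpha> i)" for i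
  define A where "A i t = (if i = 0 then \<Sum>j<m. x\<^sub>a j * RL_integral a (real j) (\<lambda>_. 1) t
      else \<Sum>j\<in>{nat \<lceil>\<alpha> i\<rceil>..<m}. x\<^sub>a j * RL_integral a (real j - \<alpha> i) (\<lambda>_. 1) t)" for i t
  have A: "continuous_on {a..b} (A i)" for i
  proof (cases "i = 0")
    case False
    have "real j - \<alpha> i \<ge> 0" if "j \<ge> nat \<lceil>\<alpha> i\<rceil>" for j using that by linarith
    then show ?thesis using False unfolding A_def[abs_def] by (auto intro!: continuous_intros)
  qed (auto simp: A_def[abs_def] intro!: continuous_intros)
  interpret volterra_system a b k \<beta> A f L
    using assms(1,6) L A \<gamma> mono by unfold_locales (auto simp: \<beta>_def \<gamma>_def)
  have args: "rhs_args a b k \<alpha> x t = arg y t"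
    if "caputo_representation a b \<gamma> x\<^sub>a y x m" "t \<in> {a..b}" for x y t
  proof -
    interpret caputo_representation a b \<gamma> x\<^sub>a y x m by fact
    show ?thesis
    proof
      fix i
      consider "i = 0" | "0 < i" "i < k" | "i \<ge> k" "i \<noteq> 0" by linarith
      then show "rhs_args a b k \<alpha> x t i = arg y t i"
      proof cases
        case 1
        then show ?thesis using assms(2) that(2) by (simp add: rhs_args_def arg_def A_def \<beta>_def x)
      next
        case 2
        then have "0 < \<alpha> i" "\<alpha> i \<le> \<gamma>" using \<alpha>_pos[of i] mono[of i k] by (auto simp: \<gamma>_def)
        from caputo_deriv_x[OF this refl that(2)] show ?thesis
          using 2 by (simp add: rhs_args_def arg_def A_def \<beta>_def)
      qed (simp add: rhs_args_def arg_def)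
    qed
  qed
  show ?thesis
  proof (rule ex_ex1I)
    obtain y where y_cont: "continuous_on {a..b} y" and y_fix: "\<And>t. t \<in> {a..b} \<Longrightarrow> y t = F y t"
      using ex_fixed_point by blast
    define x where "x = restrict (\<lambda>t. (\<Sum>i<m. x\<^sub>a i * RL_integral a (real i) (\<lambda>_. 1) t) + RL_integral a \<gamma> y t) {a..b}"
    interpret caputo_representation a b \<gamma> x\<^sub>a y x m
      using \<gamma> y_cont ab by unfold_locales (auto simp: x_def m_def)
    have "caputo_differentiable a b (\<alpha> j) x" if "j \<in> {1..<k}" for j
      using that \<alpha>_pos[of j] mono[of j k] by (intro caputo_differentiable_x) (auto simp: \<gamma>_def)
    moreover have "caputo_deriv a b \<gamma> x t = f (t, rhs_args a b k \<alpha> x t)" if "t \<in> {a..b}" for t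
      using that y_fix[OF that] args[OF caputo_representation_axioms that] by (simp add: caputo_deriv_x_top F_def)
    ultimately have "multi_term_solution a b k \<alpha> f x"
      using cont_caputo_differentiable_x by (simp add: multi_term_solution_def \<gamma>_def)
    moreover have "x \<in> extensional {a..b}" by (simp add: x_def)
    ultimately show "\<exists>x. x \<in> extensional {a..b} \<and> multi_term_solution a b k \<alpha> f x \<and>
           (\<forall>j<nat \<lceil>\<alpha> k\<rceil>. deriv_within {a..b} j x a = x\<^sub>a j)"
      using deriv_within_x_at_left_end by (auto simp: m_def \<gamma>_def)
  next
    have rep: "caputo_representation a b \<gamma> x\<^sub>a (caputo_deriv a b \<gamma> x) x m"
      and fix_pt: "\<And>t. t \<in> {a..b} \<Longrightarrow> caputo_deriv a b \<gamma> x t = F (caputo_deriv a b \<gamma> x) t"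
      if x: "multi_term_solution a b k \<alpha> f x" "\<forall>j<nat \<lceil>\<alpha> k\<rceil>. deriv_within {a..b} j x a = x\<^sub>a j" for x
    proof -
      have "caputo_representation a b \<gamma> (\<lambda>i. deriv_within {a..b} i x a) (caputo_deriv a b \<gamma> x) x m"
        using caputo_representation_of_derivative[OF ab \<gamma>] x(1)
        by (simp add: multi_term_solution_def \<gamma>_def m_def)
      \<comment> \<open>Only coefficients of index below m enter the representation, and there the
        initial conditions identify them with the prescribed values.\<close>
      then show rep: "caputo_representation a b \<gamma> x\<^sub>a (caputo_deriv a b \<gamma> x) x m"
        using x(2) by (simp add: caputo_representation_def m_def \<gamma>_def)
      show "caputo_deriv a b \<gamma> x t = F (caputo_deriv a b \<gamma> x) t" if "t \<in> {a..b}" for t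
        using x(1) that args[OF rep that] by (simp add: multi_term_solution_def F_def \<gamma>_def)
    qed
    fix x z
    assume "x \<in> extensional {a..b} \<and> multi_term_solution a b k \<alpha> f x \<and>
           (\<forall>j<nat \<lceil>\<alpha> k\<rceil>. deriv_within {a..b} j x a = x\<^sub>a j)"
    then have x: "x \<in> extensional {a..b}" "multi_term_solution a b k \<alpha> f x"
      "\<forall>j<nat \<lceil>\<alpha> k\<rceil>. deriv_within {a..b} j x a = x\<^sub>a j" by auto
    assume "z \<in> extensional {a..b} \<and> multi_term_solution a b k \<alpha> f z \<and>
           (\<forall>j<nat \<lceil>\<alpha> k\<rceil>. deriv_within {a..b} j z a = x\<^sub>a j)"
    then have z: "z \<in> extensional {a..b}" "multi_term_solution a b k \<alpha> f z"
      "\<forall>j<nat \<lceil>\<alpha> k\<rceil>. deriv_within {a..b} j z a = x\<^sub>a j" by auto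
    interpret x: caputo_representation a b \<gamma> x\<^sub>a "caputo_deriv a b \<gamma> x" x m by (rule rep[OF x(2,3)])
    interpret z: caputo_representation a b \<gamma> x\<^sub>a "caputo_deriv a b \<gamma> z" z m by (rule rep[OF z(2,3)])
    \<comment> \<open>Both top derivatives are fixed points of the same \<open>F\<close>; as the
      polynomial parts agree as well, so do the solutions.\<close>
    have "caputo_deriv a b \<gamma> x t = caputo_deriv a b \<gamma> z t" if "t \<in> {a..b}" for t
      by (rule fixed_point_unique[OF x.y fix_pt[OF x(2,3)] z.y fix_pt[OF z(2,3)] that])
    then have "RL_integral a \<gamma> (caputo_deriv a b \<gamma> x) t = RL_integral a \<gamma> (caputo_deriv a b \<gamma> z) t"
      if "t \<in> {a..b}" for t
      using that by (intro RL_integral_cong) auto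
    then show "x = z"
      using x(1) z(1) by (intro extensionalityI[of x "{a..b}"]) (auto simp: x.x z.x)
  qed
qed

end
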